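(* Let $E$ be a (real or complex) Banach lattice and let $(e^{tA})_{t\ge 0}$ be a real and individually eventually positive $C_0$-semigroup on $E$ with generator $A$. Consider the following conditions: (i) $(e^{tA})_{t\ge 0}$ is irreducible. (ii) For each $0\lneq f\in E$ and each $0\lneq\varphi\in E'$ there exists $t\in[0,\infty)$ such that $\langle\varphi,e^{tA}f\rangle\neq 0$. (iii) $(e^{tA})_{t\ge 0}$ is persistently irreducible. (iv) For each $0\lneq f\in E$, each $0\lneq\varphi\in E'$ and each $t_0\in[0,\infty)$ there exists $t\in\{0\}\cup[t_0,\infty)$ such that $\langle\varphi,e^{tA}f\rangle\neq 0$. (v) For each $0\lneq f\in E$, each $0\lneq\varphi\in E'$ and each $t_0\in[0,\infty)$ there exists $t\in[t_0,\infty)$ such that $\langle\varphi,e^{tA}f\rangle\neq 0$. Then (iii), (iv) and (v) are equivalent; moreover (iii) implies (i), (iv) implies (ii), and (ii) implies (i).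
   Context: Notation: $E_+$ is the positive cone; $f\gneq 0$ (or $0 \lneq f$) means $f\ge 0$ and $f\ne 0$; $E'$ is the dual Banach lattice. If $E$ is complex, $E_{\mathbb R}$ denotes its real part; a bounded operator $T$ is real if $T(E_{\mathbb R})\subseteq E_{\mathbb R}$, and a semigroup is real if each of its operators is real (automatic if $E$ is a real Banach lattice). A $C_0$-semigroup $(e^{tA})_{t\ge0}$ on $E$ is individually eventually positive if for each $0\le f\in E$ there exists $t_0\ge 0$ such that $e^{tA}f\ge 0$ for all $t\ge t_0$. A $C_0$-semigroup $(e^{tA})_{t\ge0}$ on $E$ is irreducible if no closed ideal $I$ of $E$ other than $\{0\}$ and $E$ satisfies $e^{tA}I\subseteq I$ for all $t\ge 0$. It is persistently irreducible if no closed ideal $I$ other than $\{0\}$ and $E$ is uniformly eventually invariant, i.e. satisfies: there is $t_0\ge0$ with $e^{tA}I\subseteq I$ for all $t\ge t_0$. *)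

theory Defs
  imports "HOL-Analysis.Analysis" "HOL-Library.Lattice_Algebras"
begin

section \<open>Real Banach lattices\<close>

class banach_lattice = banach + ordered_real_vector + lattice_ab_group_add_abs +
  assumes norm_lattice_mono: "\<bar>x\<bar> \<le> \<bar>y\<bar> \<Longrightarrow> norm x \<le> norm y"

instance real :: banach_lattice
  by standard (auto simp: abs_real_def sup_real_def)

lemma norm_abs_lattice: "norm \<bar>x\<bar> = norm (x::'a::banach_lattice)"
  by (intro antisym norm_lattice_mono) simp_all

lemma norm_mono_nonneg:
  fixes x y :: "'a::banach_lattice"
  assumes "0 \<le> x" "x \<le> y"
  shows "norm x \<le> norm y"
proof (rule norm_lattice_mono)
  have "0 \<le> y" using assms by (rule order_trans)
  then show "\<bar>x\<bar> \<le> \<bar>y\<bar>" using assms by (simp add: abs_of_nonneg)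
qed

lemma nonneg_limit:
  fixes x :: "'a::banach_lattice"
  assumes lim: "X \<longlonglongrightarrow> x" and nonneg: "\<And>n. 0 \<le> X n"
  shows "0 \<le> x"
proof -
  define p where "p = sup (- x) 0"
  have p0: "0 \<le> p" by (simp add: p_def)
  have "norm p \<le> norm (X n - x)" for n
  proof -
    have "- x \<le> X n - x" using nonneg[of n] by simp
    also have "\<dots> \<le> \<bar>X n - x\<bar>" by (rule abs_ge_self)
    finally have "p \<le> \<bar>X n - x\<bar>" by (simp add: p_def)
    then have "norm p \<le> norm \<bar>X n - x\<bar>" using p0 by (rule norm_mono_nonneg[rotated])
    then show ?thesis by (simp add: norm_abs_lattice)
  qed
  moreover have "(\<lambda>n. norm (X n - x)) \<longlonglongrightarrow> 0"
    using lim by (simp add: LIM_zero tendsto_norm_zero)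
  ultimately have "norm p \<le> 0"
    by (meson LIMSEQ_le_const)
  then have "p = 0" by simp
  then have "- x \<le> 0" unfolding p_def by (metis sup.cobounded1)
  then show ?thesis by simp
qed

lemma le_limit:
  fixes x y :: "'a::banach_lattice"
  assumes "X \<longlonglongrightarrow> x" "Y \<longlonglongrightarrow> y" "\<And>n. X n \<le> Y n"
  shows "x \<le> y"
proof -
  have "(\<lambda>n. Y n - X n) \<longlonglongrightarrow> y - x" using assms by (intro tendsto_diff)
  from nonneg_limit[OF this] show ?thesis using assms(3) by simp
qed

lemma scaleR_le_abs:
  fixes x :: "'a::banach_lattice"
  shows "c *\<^sub>R x \<le> \<bar>c\<bar> *\<^sub>R \<bar>x\<bar>"
proof (cases "0 \<le> c")
  case True
  then have "c *\<^sub>R x \<le> c *\<^sub>R \<bar>x\<bar>" by (intro scaleR_left_mono abs_ge_self)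
  then show ?thesis using True by simp
next
  case False
  have "(- c) *\<^sub>R (- x) \<le> (- c) *\<^sub>R \<bar>x\<bar>"
    using False by (intro scaleR_left_mono) (auto simp: abs_ge_minus_self)
  then show ?thesis using False by simp
qed


section \<open>The modulus on the complexification\<close>

definition rot :: "'a::real_vector \<Rightarrow> 'a \<Rightarrow> real \<Rightarrow> 'a" where
  "rot x y \<theta> = cos \<theta> *\<^sub>R x + sin \<theta> *\<^sub>R y"

text \<open>\<open>rot x y \<theta>\<close> is the real part of \<open>exp (-\<i>\<theta>) (x + \<i> y)\<close>; the modulus
  \<open>\<bar>x + \<i> y\<bar>\<close> is the supremum of these elements over all \<open>\<theta>\<close>.  It always
  exists in a Banach lattice (lemma \<open>modulus_exists\<close>).\<close>

definition is_lub :: "'a::order set \<Rightarrow> 'a \<Rightarrow> bool" where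
  "is_lub S m \<longleftrightarrow> (\<forall>s\<in>S. s \<le> m) \<and> (\<forall>b. (\<forall>s\<in>S. s \<le> b) \<longrightarrow> m \<le> b)"

definition modulus :: "'a::banach_lattice \<Rightarrow> 'a \<Rightarrow> 'a" where
  "modulus x y = (THE m. is_lub (range (rot x y)) m)"

lemma cos_lipschitz: "\<bar>cos a - cos b\<bar> \<le> \<bar>a - b\<bar>" for a b :: real
proof -
  have "\<bar>cos a - cos b\<bar> = 2 * \<bar>sin ((a + b) / 2)\<bar> * \<bar>sin ((b - a) / 2)\<bar>"
    by (simp add: cos_diff_cos abs_mult)
  also have "\<dots> \<le> 2 * 1 * \<bar>(b - a) / 2\<bar>"
    by (intro mult_mono abs_sin_x_le_abs_x) auto
  finally show ?thesis by simp
qed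

lemma sin_lipschitz: "\<bar>sin a - sin b\<bar> \<le> \<bar>a - b\<bar>" for a b :: real
  using cos_lipschitz[of "pi/2 - a" "pi/2 - b"] by (simp add: cos_diff)

lemma rot_lipschitz:
  fixes x y :: "'a::banach_lattice"
  shows "rot x y a \<le> rot x y b + \<bar>a - b\<bar> *\<^sub>R (\<bar>x\<bar> + \<bar>y\<bar>)"
proof -
  have "rot x y a - rot x y b = (cos a - cos b) *\<^sub>R x + (sin a - sin b) *\<^sub>R y"
    by (simp add: rot_def algebra_simps)
  also have "\<dots> \<le> \<bar>cos a - cos b\<bar> *\<^sub>R \<bar>x\<bar> + \<bar>sin a - sin b\<bar> *\<^sub>R \<bar>y\<bar>"
    by (intro add_mono scaleR_le_abs)
  also have "\<dots> \<le> \<bar>a - b\<bar> *\<^sub>R \<bar>x\<bar> + \<bar>a - b\<bar> *\<^sub>R \<bar>y\<bar>"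
    by (intro add_mono scaleR_right_mono cos_lipschitz sin_lipschitz) auto
  finally show ?thesis by (simp add: algebra_simps)
qed

lemma rot_le:
  fixes x y :: "'a::banach_lattice"
  shows "rot x y a \<le> \<bar>x\<bar> + \<bar>y\<bar>"
proof -
  have "rot x y a \<le> \<bar>cos a\<bar> *\<^sub>R \<bar>x\<bar> + \<bar>sin a\<bar> *\<^sub>R \<bar>y\<bar>"
    unfolding rot_def by (intro add_mono scaleR_le_abs)
  also have "\<dots> \<le> 1 *\<^sub>R \<bar>x\<bar> + 1 *\<^sub>R \<bar>y\<bar>"
    by (intro add_mono scaleR_right_mono) auto
  finally show ?thesis by simp
qed

lemma rot_periodic: "\<exists>b. 0 \<le> b \<and> b < 7 \<and> rot x y a = rot x y b"
proof -
  define b where "b = a - 2 * pi * of_int \<lfloor>a / (2 * pi)\<rfloor>"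
  have "of_int \<lfloor>a / (2 * pi)\<rfloor> \<le> a / (2 * pi)" "a / (2 * pi) < of_int \<lfloor>a / (2 * pi)\<rfloor> + 1"
    by linarith+
  then have "of_int \<lfloor>a / (2 * pi)\<rfloor> * (2 * pi) \<le> a / (2 * pi) * (2 * pi)"
      "a / (2 * pi) * (2 * pi) < (of_int \<lfloor>a / (2 * pi)\<rfloor> + 1) * (2 * pi)"
    by (intro mult_right_mono mult_strict_right_mono; simp)+
  then have "0 \<le> b" "b < 2 * pi"
    by (auto simp: b_def algebra_simps)
  moreover have "2 * pi < 7" using pi_approx by simp
  moreover have "cos b = cos a" "sin b = sin a"
    by (auto simp: b_def cos_diff sin_diff cos_int_2pin sin_int_2pin)
  ultimately show ?thesis by (intro exI[of _ b]) (auto simp: rot_def)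
qed

lemma modulus_exists:
  fixes x y :: "'a::banach_lattice"
  shows "\<exists>m. is_lub (range (rot x y)) m"
proof -
  define c where "c = \<bar>x\<bar> + \<bar>y\<bar>"
  have c0: "0 \<le> c" by (simp add: c_def)
  define N where "N n = real (Suc n)" for n
  have Npos: "0 < N n" for n by (simp add: N_def)
  define F where "F n = (\<lambda>k. rot x y (real k / N n)) ` {..7 * Suc n}" for n
  define u where "u n = Sup_fin (F n)" for n
  have fin: "finite (F n)" "F n \<noteq> {}" for n by (auto simp: F_def)
  have upper: "rot x y a \<le> u n + (1 / N n) *\<^sub>R c" for a n
  proof -
    obtain b where b: "0 \<le> b" "b < 7" "rot x y a = rot x y b"
      using rot_periodic by blast
    define k where "k = nat \<lfloor>b * N n\<rfloor>"
    have bN: "0 \<le> b * N n" using b Npos[of n] by simp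
    have k: "real k \<le> b * N n" "b * N n < real k + 1"
      using bN by (auto simp: k_def)
    have "b * N n \<le> 7 * N n" using b Npos[of n] by simp
    then have "real k \<le> real (7 * Suc n)" using k by (simp add: N_def)
    then have "k \<le> 7 * Suc n" by (simp only: of_nat_le_iff)
    then have "rot x y (real k / N n) \<in> F n" by (auto simp: F_def)
    then have le: "rot x y (real k / N n) \<le> u n"
      unfolding u_def using fin by (intro Sup_fin.coboundedI)
    have "\<bar>b - real k / N n\<bar> \<le> 1 / N n"
    proof -
      have "b - real k / N n = (b * N n - real k) / N n"
        using Npos[of n] by (simp add: field_simps)
      then show ?thesis using k Npos[of n]
        by (auto simp: abs_divide intro!: divide_right_mono)
    qed
    then have "\<bar>b - real k / N n\<bar> *\<^sub>R c \<le> (1 / N n) *\<^sub>R c"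
      using c0 by (rule scaleR_right_mono)
    then show ?thesis
      using rot_lipschitz[of x y b "real k / N n"] le b(3)
      unfolding c_def[symmetric] by (metis add_mono order_trans)
  qed
  have least: "u n \<le> b" if "\<forall>s\<in>range (rot x y). s \<le> b" for n b
    unfolding u_def using fin[of n] that
    by (subst Sup_fin.bounded_iff) (auto simp: F_def)
  have step: "u m \<le> u n + (1 / N n) *\<^sub>R c" for m n
    by (rule least) (auto intro: upper)
  have dist: "norm (u m - u n) \<le> (1 / N m + 1 / N n) * norm c" for m n
  proof -
    have e: "0 \<le> (1 / N m) *\<^sub>R c" "0 \<le> (1 / N n) *\<^sub>R c"
      using c0 Npos[of m] Npos[of n] by (auto intro!: scaleR_nonneg_nonneg)
    have "u m - u n \<le> (1 / N n) *\<^sub>R c" "u n - u m \<le> (1 / N m) *\<^sub>R c"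
      using step[of m n] step[of n m] by (simp_all only: diff_le_eq add.commute)
    then have "u m - u n \<le> (1 / N m) *\<^sub>R c + (1 / N n) *\<^sub>R c"
        "- (u m - u n) \<le> (1 / N m) *\<^sub>R c + (1 / N n) *\<^sub>R c"
      using e by (simp_all only: minus_diff_eq add_increasing add_increasing2)
    then have "\<bar>u m - u n\<bar> \<le> (1 / N m) *\<^sub>R c + (1 / N n) *\<^sub>R c"
      by (rule abs_leI)
    then have "norm \<bar>u m - u n\<bar> \<le> norm ((1 / N m) *\<^sub>R c + (1 / N n) *\<^sub>R c)"
      by (intro norm_mono_nonneg) auto
    also have "\<dots> = norm ((1 / N m + 1 / N n) *\<^sub>R c)"
      by (simp add: scaleR_left_distrib)
    also have "\<dots> = (1 / N m + 1 / N n) * norm c"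
      using Npos[of m] Npos[of n] by (simp add: abs_of_pos add_pos_pos)
    finally show ?thesis by (simp add: norm_abs_lattice)
  qed
  have inv: "(\<lambda>n. 1 / N n) \<longlonglongrightarrow> 0"
    unfolding N_def using LIMSEQ_inverse_real_of_nat by (simp add: inverse_eq_divide)
  have "Cauchy u"
  proof (rule CauchyI)
    fix e :: real assume "0 < e"
    have "(\<lambda>n. 2 * (1 / N n) * norm c) \<longlonglongrightarrow> 2 * 0 * norm c"
      by (intro tendsto_intros inv)
    then have "\<forall>\<^sub>F n in sequentially. 2 * (1 / N n) * norm c < e"
      using \<open>0 < e\<close> by (intro order_tendstoD) auto
    then obtain M where M: "2 * (1 / N M) * norm c < e"
      unfolding eventually_sequentially by blast
    have "norm (u m - u n) < e" if "M \<le> m" "M \<le> n" for m n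
    proof -
      have "1 / N m \<le> 1 / N M" "1 / N n \<le> 1 / N M"
        using that by (auto simp: N_def field_simps)
      then have "(1 / N m + 1 / N n) * norm c \<le> (2 * (1 / N M)) * norm c"
        by (intro mult_right_mono) auto
      then show ?thesis using dist[of m n] M by linarith
    qed
    then show "\<exists>M. \<forall>m\<ge>M. \<forall>n\<ge>M. norm (u m - u n) < e" by blast
  qed
  then obtain L where L: "u \<longlonglongrightarrow> L"
    using Cauchy_convergent unfolding convergent_def by blast
  have "(\<lambda>n. u n + (1 / N n) *\<^sub>R c) \<longlonglongrightarrow> L + 0 *\<^sub>R c"
    by (intro tendsto_intros L inv)
  then have "(\<lambda>n. u n + (1 / N n) *\<^sub>R c) \<longlonglongrightarrow> L" by simp
  then have "rot x y a \<le> L" for a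
    by (rule le_limit[OF tendsto_const]) (rule upper)
  moreover have "L \<le> b" if "\<forall>s\<in>range (rot x y). s \<le> b" for b
    by (rule le_limit[OF L tendsto_const]) (rule least[OF that])
  ultimately show ?thesis unfolding is_lub_def by blast
qed

lemma is_lub_modulus:
  fixes x y :: "'a::banach_lattice"
  shows "is_lub (range (rot x y)) (modulus x y)"
  unfolding modulus_def
proof (rule theI')
  show "\<exists>!m. is_lub (range (rot x y)) m"
    using modulus_exists[of x y] by (auto simp: is_lub_def intro: antisym)
qed

lemma rot_le_modulus: "rot x y a \<le> modulus x y" for x y :: "'a::banach_lattice"
  using is_lub_modulus[of x y] by (auto simp: is_lub_def)

lemma modulus_least:
  fixes x y :: "'a::banach_lattice"
  assumes "\<And>a. rot x y a \<le> b"
  shows "modulus x y \<le> b"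
  using is_lub_modulus[of x y] assms by (auto simp: is_lub_def)

lemma modulus_le: "modulus x y \<le> \<bar>x\<bar> + \<bar>y\<bar>" for x y :: "'a::banach_lattice"
  by (intro modulus_least rot_le)

lemma abs_le_modulus:
  fixes x y :: "'a::banach_lattice"
  shows "\<bar>x\<bar> \<le> modulus x y" "\<bar>y\<bar> \<le> modulus x y"
  using rot_le_modulus[of x y 0] rot_le_modulus[of x y pi]
    rot_le_modulus[of x y "pi / 2"] rot_le_modulus[of x y "- (pi / 2)"]
  by (auto simp: rot_def intro: abs_leI)

lemma modulus_nonneg [simp]: "0 \<le> modulus x y" for x y :: "'a::banach_lattice"
  using order_trans[OF abs_ge_zero abs_le_modulus(1)] .

lemma modulus_real [simp]: "modulus x 0 = \<bar>x\<bar>" for x :: "'a::banach_lattice"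
  using abs_le_modulus(1)[of x 0] modulus_le[of x 0] by (simp add: antisym)

lemma modulus_eq_0_iff: "modulus x y = 0 \<longleftrightarrow> x = 0 \<and> y = 0" for x y :: "'a::banach_lattice"
proof
  assume "modulus x y = 0"
  with abs_le_modulus(1)[of x y] abs_le_modulus(2)[of y x] have "\<bar>x\<bar> \<le> 0" "\<bar>y\<bar> \<le> 0" by (simp_all only:)
  then show "x = 0 \<and> y = 0" by simp
qed simp

lemma modulus_add: "modulus (x + x') (y + y') \<le> modulus x y + modulus x' y'"
  for x y :: "'a::banach_lattice"
proof (rule modulus_least)
  fix a
  have "rot (x + x') (y + y') a = rot x y a + rot x' y' a"
    by (simp add: rot_def algebra_simps)
  then show "rot (x + x') (y + y') a \<le> modulus x y + modulus x' y'"
    by (simp add: add_mono rot_le_modulus)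
qed

lemma modulus_rotate:
  fixes x y :: "'a::banach_lattice"
  shows "modulus (Re c *\<^sub>R x - Im c *\<^sub>R y) (Re c *\<^sub>R y + Im c *\<^sub>R x) = cmod c *\<^sub>R modulus x y"
proof -
  have le: "modulus (Re c *\<^sub>R x - Im c *\<^sub>R y) (Re c *\<^sub>R y + Im c *\<^sub>R x) \<le> cmod c *\<^sub>R modulus x y"
    for c and x y :: 'a
  proof (rule modulus_least)
    fix a
    obtain r p where c: "Re c = r * cos p" "Im c = r * sin p" "cmod c = r"
      using Re_rcis[of "cmod c" "Arg c"] Im_rcis[of "cmod c" "Arg c"]
      unfolding rcis_cmod_Arg by blast
    have "rot (Re c *\<^sub>R x - Im c *\<^sub>R y) (Re c *\<^sub>R y + Im c *\<^sub>R x) a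
        = cmod c *\<^sub>R rot x y (a - p)"
      unfolding c by (simp add: rot_def cos_diff sin_diff algebra_simps)
    also have "\<dots> \<le> cmod c *\<^sub>R modulus x y"
      by (intro scaleR_left_mono rot_le_modulus) auto
    finally show "rot (Re c *\<^sub>R x - Im c *\<^sub>R y) (Re c *\<^sub>R y + Im c *\<^sub>R x) a \<le> \<dots>" .
  qed
  show ?thesis
  proof (cases "c = 0")
    case True
    then show ?thesis by simp
  next
    case False
    define d where "d = inverse c"
    define x' y' where "x' = Re c *\<^sub>R x - Im c *\<^sub>R y" and "y' = Re c *\<^sub>R y + Im c *\<^sub>R x"
    have "d * c = 1" using False by (simp add: d_def)
    then have d: "Re d * Re c - Im d * Im c = 1" "Re d * Im c + Im d * Re c = 0"
      by (auto simp: complex_eq_iff)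
    have "Re d *\<^sub>R x' - Im d *\<^sub>R y'
        = (Re d * Re c - Im d * Im c) *\<^sub>R x - (Re d * Im c + Im d * Re c) *\<^sub>R y"
      "Re d *\<^sub>R y' + Im d *\<^sub>R x'
        = (Re d * Re c - Im d * Im c) *\<^sub>R y + (Re d * Im c + Im d * Re c) *\<^sub>R x"
      unfolding x'_def y'_def by (simp_all add: algebra_simps)
    then have inverted: "Re d *\<^sub>R x' - Im d *\<^sub>R y' = x" "Re d *\<^sub>R y' + Im d *\<^sub>R x' = y"
      using d by simp_all
    have "modulus x y \<le> cmod d *\<^sub>R modulus x' y'"
      using le[of d x' y'] inverted by simp
    then have "cmod c *\<^sub>R modulus x y \<le> cmod c *\<^sub>R (cmod d *\<^sub>R modulus x' y')"
      by (intro scaleR_left_mono) auto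
    also have "\<dots> = modulus x' y'"
      using False by (simp add: d_def norm_inverse)
    finally show ?thesis using le[of c x y] unfolding x'_def y'_def by (intro antisym)
  qed
qed

lemma modulus_scaleR:
  "modulus (r *\<^sub>R x) (r *\<^sub>R y) = \<bar>r\<bar> *\<^sub>R modulus x y" for x y :: "'a::banach_lattice"
  using modulus_rotate[of "of_real r" x y] by simp


section \<open>Complex Banach lattices\<close>

text \<open>A complex Banach lattice is the complexification \<open>E\<^sub>\<real> + \<i> E\<^sub>\<real>\<close> of a real Banach
  lattice \<open>E\<^sub>\<real>\<close>, normed by the norm of the modulus.\<close>

datatype 'a complexification = Complexify (real_part: 'a) (imag_part: 'a)

lemma cx_eqI: "real_part z = real_part w \<Longrightarrow> imag_part z = imag_part w \<Longrightarrow> z = w"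
  by (simp add: complexification.expand)

instantiation complexification :: (real_vector) real_vector
begin
definition "0 = Complexify 0 0"
definition "z + w = Complexify (real_part z + real_part w) (imag_part z + imag_part w)"
definition "z - w = Complexify (real_part z - real_part w) (imag_part z - imag_part w)"
definition "- z = Complexify (- real_part z) (- imag_part z)"
definition "r *\<^sub>R z = Complexify (r *\<^sub>R real_part z) (r *\<^sub>R imag_part z)"
instance
  by standard
    (auto simp: zero_complexification_def plus_complexification_def minus_complexification_def
      uminus_complexification_def scaleR_complexification_def algebra_simps
      intro: cx_eqI)
end

lemma parts_simps [simp]:
  "real_part 0 = 0" "imag_part 0 = 0"
  "real_part (z + w) = real_part z + real_part w" "imag_part (z + w) = imag_part z + imag_part w"
  "real_part (z - w) = real_part z - real_part w" "imag_part (z - w) = imag_part z - imag_part w"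
  "real_part (- z) = - real_part z" "imag_part (- z) = - imag_part z"
  "real_part (r *\<^sub>R z) = r *\<^sub>R real_part z" "imag_part (r *\<^sub>R z) = r *\<^sub>R imag_part z"
  by (auto simp: zero_complexification_def plus_complexification_def minus_complexification_def
      uminus_complexification_def scaleR_complexification_def)

definition scaleC :: "complex \<Rightarrow> 'a::real_vector complexification \<Rightarrow> 'a complexification" where
  "scaleC c z = Complexify (Re c *\<^sub>R real_part z - Im c *\<^sub>R imag_part z)
                           (Re c *\<^sub>R imag_part z + Im c *\<^sub>R real_part z)"

lemma vector_space_scaleC: "vector_space scaleC"
  by unfold_locales (auto intro!: cx_eqI simp: scaleC_def algebra_simps)

lemma scaleC_of_real: "scaleC (of_real r) z = r *\<^sub>R z"
  by (rule cx_eqI) (simp_all add: scaleC_def)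

text \<open>The order: the positive cone of the complexification is that of \<open>E\<^sub>\<real>\<close>.  The modulus
  is regarded as an element of the complexification with vanishing imaginary part.\<close>

instantiation complexification :: (ordered_real_vector) ordered_real_vector
begin
definition "z \<le> w \<longleftrightarrow> real_part z \<le> real_part w \<and> imag_part z = imag_part w"
definition "z < w \<longleftrightarrow> z \<le> w \<and> \<not> w \<le> (z :: 'a complexification)"
instance
  by standard
    (auto simp: less_eq_complexification_def less_complexification_def
      intro: cx_eqI scaleR_left_mono scaleR_right_mono)
end

instantiation complexification :: (banach_lattice) abs
begin
definition "\<bar>z\<bar> = Complexify (modulus (real_part z) (imag_part z)) 0"
instance ..
end

instantiation complexification :: (banach_lattice) real_normed_vector
begin
definition "norm z = norm (modulus (real_part z) (imag_part z))"
definition "sgn z = inverse (norm z) *\<^sub>R (z :: 'a complexification)"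
definition "dist z w = norm (z - w :: 'a complexification)"
definition [code del]:
  "uniformity = (INF e\<in>{0<..}. principal {(z, w :: 'a complexification). dist z w < e})"
definition [code del]:
  "open (U :: 'a complexification set) \<longleftrightarrow>
    (\<forall>z\<in>U. \<forall>\<^sub>F (z', w) in uniformity. z' = z \<longrightarrow> w \<in> U)"
instance
proof
  fix z w :: "'a complexification" and r :: real
  show "norm z = 0 \<longleftrightarrow> z = 0"
    by (auto simp: norm_complexification_def modulus_eq_0_iff intro: cx_eqI)
  have "norm (modulus (real_part (z + w)) (imag_part (z + w)))
      \<le> norm (modulus (real_part z) (imag_part z) + modulus (real_part w) (imag_part w))"
    by (intro norm_mono_nonneg) (auto simp: modulus_add)
  then show "norm (z + w) \<le> norm z + norm w"
    unfolding norm_complexification_def by (rule order_trans) (rule norm_triangle_ineq)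
  show "norm (r *\<^sub>R z) = \<bar>r\<bar> * norm z"
    by (simp add: norm_complexification_def modulus_scaleR)
qed (rule dist_complexification_def sgn_complexification_def
      uniformity_complexification_def open_complexification_def)+
end

lemma norm_parts_le:
  fixes z :: "'a::banach_lattice complexification"
  shows "norm (real_part z) \<le> norm z" "norm (imag_part z) \<le> norm z"
    "norm z \<le> norm (real_part z) + norm (imag_part z)"
proof -
  show "norm (real_part z) \<le> norm z" "norm (imag_part z) \<le> norm z"
    unfolding norm_complexification_def
    by (auto intro!: norm_lattice_mono simp: abs_le_modulus)
  have "norm z \<le> norm (\<bar>real_part z\<bar> + \<bar>imag_part z\<bar>)"
    unfolding norm_complexification_def by (intro norm_mono_nonneg modulus_le) simp
  also have "\<dots> \<le> norm (real_part z) + norm (imag_part z)"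
    using norm_triangle_ineq[of "\<bar>real_part z\<bar>" "\<bar>imag_part z\<bar>"] by (simp add: norm_abs_lattice)
  finally show "norm z \<le> norm (real_part z) + norm (imag_part z)" .
qed

lemma norm_scaleC: "norm (scaleC c z) = cmod c * norm z"
  for z :: "'a::banach_lattice complexification"
  by (simp add: norm_complexification_def scaleC_def modulus_rotate)

lemma norm_abs_complexification: "norm \<bar>z\<bar> = norm z"
  for z :: "'a::banach_lattice complexification"
  by (simp add: norm_complexification_def abs_complexification_def norm_abs_lattice)

lemma norm_Complexify_0: "norm (Complexify x 0) = norm x"
  for x :: "'a::banach_lattice"
  by (simp add: norm_complexification_def norm_abs_lattice)

instance complexification :: (banach_lattice) banach
proof
  fix X :: "nat \<Rightarrow> 'a complexification"
  assume X: "Cauchy X"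
  have "norm (real_part (X m) - real_part (X n)) \<le> norm (X m - X n)"
    "norm (imag_part (X m) - imag_part (X n)) \<le> norm (X m - X n)" for m n
    using norm_parts_le[of "X m - X n"] by simp_all
  then have "Cauchy (\<lambda>n. real_part (X n))" "Cauchy (\<lambda>n. imag_part (X n))"
    using X unfolding Cauchy_iff by (meson order_le_less_trans)+
  then obtain x y where xy: "(\<lambda>n. real_part (X n)) \<longlonglongrightarrow> x" "(\<lambda>n. imag_part (X n)) \<longlonglongrightarrow> y"
    using Cauchy_convergent unfolding convergent_def by blast
  have "(\<lambda>n. norm (real_part (X n) - x) + norm (imag_part (X n) - y)) \<longlonglongrightarrow> 0 + 0"
    by (intro tendsto_add) (use xy in \<open>auto simp: LIM_zero tendsto_norm_zero\<close>)
  then have "(\<lambda>n. norm (real_part (X n) - x) + norm (imag_part (X n) - y)) \<longlonglongrightarrow> 0" by simp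
  then have "(\<lambda>n. norm (X n - Complexify x y)) \<longlonglongrightarrow> 0"
    by (rule tendsto_0_le[where K = 1])
      (auto intro!: always_eventually intro: order_trans[OF norm_parts_le(3)])
  then have "X \<longlonglongrightarrow> Complexify x y"
    by (simp add: LIM_zero_iff tendsto_norm_zero_iff)
  then show "convergent X" by (auto simp: convergent_def)
qed


section \<open>Operators, functionals and ideals\<close>

text \<open>The definitions below serve real and complex Banach lattices simultaneously: \<open>sc\<close> is the
  scalar multiplication, \<^const>\<open>scaleR\<close> in the real and \<^const>\<open>scaleC\<close> in the complex case.\<close>

definition bounded_operator ::
  "('k::field \<Rightarrow> 'e::real_normed_vector \<Rightarrow> 'e) \<Rightarrow> ('k \<Rightarrow> 'f::real_normed_vector \<Rightarrow> 'f)
    \<Rightarrow> ('e \<Rightarrow> 'f) \<Rightarrow> bool" where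
  "bounded_operator sc sc' T \<longleftrightarrow>
    Vector_Spaces.linear sc sc' T \<and> (\<exists>K. \<forall>x. norm (T x) \<le> K * norm x)"

lemma bounded_operator_scaleR: "bounded_operator scaleR scaleR T \<longleftrightarrow> bounded_linear T"
proof
  assume T: "bounded_operator scaleR scaleR T"
  then interpret Vector_Spaces.linear scaleR scaleR T by (simp add: bounded_operator_def)
  obtain K where "\<forall>x. norm (T x) \<le> K * norm x"
    using T unfolding bounded_operator_def by blast
  then show "bounded_linear T"
    by (intro bounded_linear_intro[where K = K]) (auto simp: add scale mult.commute)
next
  assume "bounded_linear T"
  then interpret bounded_linear T .
  have "Vector_Spaces.linear scaleR scaleR T"
    using linear_axioms by (simp add: linear_def)
  moreover obtain K where "\<And>x. norm (T x) \<le> norm x * K" using bounded by blast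
  ultimately show "bounded_operator scaleR scaleR T"
    unfolding bounded_operator_def by (metis mult.commute)
qed

definition dual :: "('k::real_normed_field \<Rightarrow> 'e::real_normed_vector \<Rightarrow> 'e) \<Rightarrow> ('e \<Rightarrow> 'k) set" where
  "dual sc = {\<phi>. bounded_operator sc (*) \<phi>}"

text \<open>The order of the dual Banach lattice: \<open>0 \<le> \<phi>\<close> iff \<open>\<phi> f \<ge> 0\<close> (real and nonnegative)
  for all \<open>f \<ge> 0\<close>.\<close>

definition pos_functional ::
  "('k::real_normed_field \<Rightarrow> 'e::{real_normed_vector,ord} \<Rightarrow> 'e) \<Rightarrow> ('e \<Rightarrow> 'k) \<Rightarrow> bool" where
  "pos_functional sc \<phi> \<longleftrightarrow> \<phi> \<in> dual sc \<and> (\<forall>f\<ge>0. \<phi> f \<in> \<real>\<^sub>\<ge>\<^sub>0)"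

definition closed_ideal ::
  "('k::field \<Rightarrow> 'e::{real_normed_vector,ord,abs} \<Rightarrow> 'e) \<Rightarrow> 'e set \<Rightarrow> bool" where
  "closed_ideal sc I \<longleftrightarrow>
    module.subspace sc I \<and> (\<forall>x y. y \<in> I \<and> \<bar>x\<bar> \<le> \<bar>y\<bar> \<longrightarrow> x \<in> I) \<and> closed I"


section \<open>Semigroups\<close>

text \<open>A semigroup is a function on \<^typ>\<open>real\<close> of which only the values at \<open>t \<ge> 0\<close> matter;
  \<open>T t\<close> is \<open>exp (t A)\<close>.  The generator, an in general only partially defined operator, is
  represented by its graph.\<close>

definition C0_semigroup ::
  "('k::field \<Rightarrow> 'e::real_normed_vector \<Rightarrow> 'e) \<Rightarrow> (real \<Rightarrow> 'e \<Rightarrow> 'e) \<Rightarrow> bool" where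
  "C0_semigroup sc T \<longleftrightarrow>
    (\<forall>t\<ge>0. bounded_operator sc sc (T t)) \<and>
    (\<forall>f. T 0 f = f) \<and>
    (\<forall>s\<ge>0. \<forall>t\<ge>0. \<forall>f. T (s + t) f = T s (T t f)) \<and>
    (\<forall>f. ((\<lambda>t. T t f) \<longlongrightarrow> f) (at_right 0))"

definition generator :: "(real \<Rightarrow> 'e::real_normed_vector \<Rightarrow> 'e) \<Rightarrow> ('e \<times> 'e) set" where
  "generator T = {(f, g). ((\<lambda>t. (1 / t) *\<^sub>R (T t f - f)) \<longlongrightarrow> g) (at_right 0)}"

text \<open>Reality of an operator is only needed on complex Banach lattices; on a real one every
  operator is real.\<close>

definition real_operator :: "('a::zero complexification \<Rightarrow> 'a complexification) \<Rightarrow> bool" where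
  "real_operator T \<longleftrightarrow> T ` {f. imag_part f = 0} \<subseteq> {f. imag_part f = 0}"

definition real_semigroup ::
  "(real \<Rightarrow> 'a::zero complexification \<Rightarrow> 'a complexification) \<Rightarrow> bool" where
  "real_semigroup T \<longleftrightarrow> (\<forall>t\<ge>0. real_operator (T t))"

definition indiv_eventually_positive :: "(real \<Rightarrow> 'e::{zero,ord} \<Rightarrow> 'e) \<Rightarrow> bool" where
  "indiv_eventually_positive T \<longleftrightarrow> (\<forall>f\<ge>0. \<exists>t\<^sub>0\<ge>0. \<forall>t\<ge>t\<^sub>0. T t f \<ge> 0)"

definition irreducible_semigroup ::
  "('k::field \<Rightarrow> 'e::{real_normed_vector,ord,abs} \<Rightarrow> 'e) \<Rightarrow> (real \<Rightarrow> 'e \<Rightarrow> 'e) \<Rightarrow> bool" where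
  "irreducible_semigroup sc T \<longleftrightarrow>
    \<not> (\<exists>I. closed_ideal sc I \<and> I \<noteq> {0} \<and> I \<noteq> UNIV \<and> (\<forall>t\<ge>0. T t ` I \<subseteq> I))"

definition persistently_irreducible ::
  "('k::field \<Rightarrow> 'e::{real_normed_vector,ord,abs} \<Rightarrow> 'e) \<Rightarrow> (real \<Rightarrow> 'e \<Rightarrow> 'e) \<Rightarrow> bool" where
  "persistently_irreducible sc T \<longleftrightarrow>
    \<not> (\<exists>I. closed_ideal sc I \<and> I \<noteq> {0} \<and> I \<noteq> UNIV \<and>
         (\<exists>t\<^sub>0\<ge>0. \<forall>t\<ge>t\<^sub>0. T t ` I \<subseteq> I))"

end

theory Submission
  imports Defs
begin

text \<open>
  The main implication is from (iii) to (v).  Suppose that \<open>\<phi>\<close> vanishes on the orbit of \<open>f\<close> from some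
  time on.  Let \<open>h\<close> be a weighted sum of vectors \<open>T t f \<ge> 0\<close> over a dense set of large times \<open>t\<close>.  The
  closed ideal generated by \<open>h\<close> is annihilated by \<open>\<phi>\<close>, and individual eventual positivity sends every
  element of the order interval \<open>[0, h]\<close> eventually into it.  Baire's theorem on \<open>[0, h]\<close> makes the
  waiting time uniform, so the ideal is uniformly eventually invariant and hence zero.  Then the orbit
  of \<open>f\<close> vanishes eventually, and the same argument shows that the semigroup is nilpotent.  So
  every closed ideal is eventually invariant, hence trivial; the space is at most one-dimensional, and
  a nilpotent semigroup on a line contradicts strong continuity.

  The implications to (i) and (iii) separate an invariant closed ideal from the space by a positive
  functional.  The complex case reduces to the real part of the space.
\<close>

section \<open>Tools from functional analysis\<close>

text \<open>As a closed subset of a complete space, \<open>K\<close> is completely metrizable. If no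
  \<open>C n\<close> contained a relative ball, every \<open>K \<inter> C n\<close> would be closed
  with empty relative interior, hence so would their union; but that union is
  \<open>K\<close>.\<close>

lemma closed_cover_has_interior:
  fixes K :: "'a::complete_space set" and C :: "nat \<Rightarrow> 'a set"
  assumes K: "closed K" "K \<noteq> {}" and C: "\<And>n. closed (C n)" and cover: "K \<subseteq> (\<Union>n. C n)"
  shows "\<exists>n. \<exists>x\<in>K. \<exists>r>0. ball x r \<inter> K \<subseteq> C n"
proof (rule ccontr)
  assume contra: "\<not> ?thesis"
  let ?X = "subtopology euclidean K"
  have "?X interior_of (\<Union>(range (\<lambda>n. K \<inter> C n))) = {}"
  proof (rule Baire_category_alt)
    show "completely_metrizable_space ?X \<or> locally_compact_space ?X \<and> regular_space ?X"
      using completely_metrizable_space_closedin[OF completely_metrizable_space_euclidean, of K] K(1)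
      by auto
    fix S assume "S \<in> range (\<lambda>n. K \<inter> C n)"
    then obtain n where S: "S = K \<inter> C n" by blast
    have "?X interior_of S = {}"
    proof (rule ccontr)
      assume "?X interior_of S \<noteq> {}"
      then obtain x U where U: "openin ?X U" "x \<in> U" "U \<subseteq> S"
        unfolding interior_of_def by auto
      then obtain V where V: "open V" "U = K \<inter> V"
        by (auto simp: openin_open)
      then obtain r where "0 < r" "ball x r \<subseteq> V"
        using U(2) open_contains_ball by blast
      then have "x \<in> K" "ball x r \<inter> K \<subseteq> C n" using U V S by blast+
      then show False using contra \<open>0 < r\<close> by blast
    qed
    then show "closedin ?X S \<and> ?X interior_of S = {}"
      using S C by (simp add: closedin_closed_Int)
  qed simp
  moreover have "(\<Union>(range (\<lambda>n. K \<inter> C n))) = K" using cover by blast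
  moreover have "?X interior_of K = K"
    using interior_of_topspace[of ?X] by simp
  ultimately show False using K(2) by simp
qed

section \<open>Sublinear functionals and the Hahn--Banach theorem\<close>

definition sublinear :: "('a::real_vector \<Rightarrow> real) \<Rightarrow> bool" where
  "sublinear p \<longleftrightarrow> (\<forall>x y. p (x + y) \<le> p x + p y) \<and> (\<forall>c\<ge>0. \<forall>x. p (c *\<^sub>R x) = c * p x)"

text \<open>One inequality for positive scalars is enough: used with \<open>inverse c\<close> at
  \<open>c *\<^sub>R x\<close> it gives the reverse one.\<close>

lemma sublinearI:
  assumes "\<And>x y. p (x + y) \<le> p x + p y" and "\<And>c x. 0 < c \<Longrightarrow> p (c *\<^sub>R x) \<le> c * p x" and "p 0 = 0"
  shows "sublinear p"
  unfolding sublinear_def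
proof (intro conjI allI impI assms(1))
  fix c :: real and x assume "0 \<le> c"
  show "p (c *\<^sub>R x) = c * p x"
  proof (cases "c = 0")
    case False
    then have c: "0 < c" using \<open>0 \<le> c\<close> by simp
    have "p (inverse c *\<^sub>R c *\<^sub>R x) \<le> inverse c * p (c *\<^sub>R x)" using c by (intro assms(2)) simp
    then have "c * p x \<le> p (c *\<^sub>R x)" using c by (simp add: field_simps)
    then show ?thesis using assms(2)[OF c, of x] by simp
  qed (simp add: assms(3))
qed

lemma
  assumes "sublinear p"
  shows sublinear_add: "p (x + y) \<le> p x + p y"
    and sublinear_scale: "0 \<le> c \<Longrightarrow> p (c *\<^sub>R x) = c * p x"
    and sublinear_zero: "p 0 = 0"
    and sublinear_minus: "- p (- x) \<le> p x"
proof -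
  show *: "p (x + y) \<le> p x + p y" for x y using assms by (simp add: sublinear_def)
  show scale: "0 \<le> c \<Longrightarrow> p (c *\<^sub>R x) = c * p x" for c x using assms by (simp add: sublinear_def)
  show "p 0 = 0" using scale[of 0 0] by simp
  then show "- p (- x) \<le> p x" using *[of x "- x"] by simp
qed

text \<open>For sublinear \<open>p\<close> this is the largest sublinear functional below
  \<open>p\<close> whose value at \<open>- v\<close> is at most \<open>- p v\<close>.\<close>

definition push :: "'a::real_vector \<Rightarrow> ('a \<Rightarrow> real) \<Rightarrow> 'a \<Rightarrow> real" where
  "push v p x = (INF t\<in>{0..}. p (x + t *\<^sub>R v) - t * p v)"

lemma push_lower:
  assumes "sublinear p" "0 \<le> t"
  shows "push v p x \<le> p (x + t *\<^sub>R v) - t * p v"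
  unfolding push_def
proof (rule cINF_lower)
  \<comment> \<open>A lower bound independent of \<open>t\<close>, so that the real infimum is a
    genuine one.\<close>
  have "- p (- x) \<le> p (x + t *\<^sub>R v) - t * p v" if "0 \<le> t" for t
    using sublinear_add[OF assms(1), of "x + t *\<^sub>R v" "- x"] sublinear_scale[OF assms(1) that, of v]
    by simp
  then show "bdd_below ((\<lambda>t. p (x + t *\<^sub>R v) - t * p v) ` {0..})"
    by (intro bdd_belowI2[where m = "- p (- x)"]) auto
qed (use assms in simp)

lemma push_greatest:
  assumes "\<And>t. 0 \<le> t \<Longrightarrow> b \<le> p (x + t *\<^sub>R v) - t * p v"
  shows "b \<le> push v p x"
  unfolding push_def by (rule cINF_greatest) (use assms in auto)

lemma push_le: "sublinear p \<Longrightarrow> push v p x \<le> p x"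
  using push_lower[of p 0 v x] by simp

lemma push_minus:
  assumes "sublinear p"
  shows "push v p (- v) \<le> - p v"
  using push_lower[OF assms, of 1 v "- v"] sublinear_zero[OF assms] by simp

text \<open>Parameters \<open>t\<close> for \<open>x\<close> and \<open>s\<close> for
  \<open>y\<close> combine to \<open>t + s\<close> for \<open>x + y\<close>, and
  \<open>c * t\<close> serves \<open>c *\<^sub>R x\<close>; the two infima are then taken one after
  the other.\<close>

lemma sublinear_push:
  assumes p: "sublinear p"
  shows "sublinear (push v p)"
proof (rule sublinearI)
  fix x y
  have sum: "push v p (x + y) \<le> (p (x + t *\<^sub>R v) - t * p v) + (p (y + s *\<^sub>R v) - s * p v)"
    if "0 \<le> t" "0 \<le> s" for s t
  proof -
    have "push v p (x + y) \<le> p (x + y + (t + s) *\<^sub>R v) - (t + s) * p v"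
      using that by (intro push_lower p) simp
    also have "p (x + y + (t + s) *\<^sub>R v) \<le> p (x + t *\<^sub>R v) + p (y + s *\<^sub>R v)"
      using sublinear_add[OF p, of "x + t *\<^sub>R v" "y + s *\<^sub>R v"] by (simp add: algebra_simps)
    finally show ?thesis by (simp add: algebra_simps)
  qed
  have "push v p (x + y) - (p (x + t *\<^sub>R v) - t * p v) \<le> push v p y" if "0 \<le> t" for t
    by (rule push_greatest) (use sum[OF that] in \<open>simp add: algebra_simps\<close>)
  then have "push v p (x + y) - push v p y \<le> push v p x"
    by (intro push_greatest) (simp add: algebra_simps)
  then show "push v p (x + y) \<le> push v p x + push v p y" by simp
next
  fix c :: real and x assume c: "0 < c"
  have "push v p (c *\<^sub>R x) / c \<le> p (x + t *\<^sub>R v) - t * p v" if "0 \<le> t" for t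
  proof -
    have "push v p (c *\<^sub>R x) \<le> p (c *\<^sub>R x + (c * t) *\<^sub>R v) - (c * t) * p v"
      using that c by (intro push_lower p) simp
    also have "\<dots> = c * (p (x + t *\<^sub>R v) - t * p v)"
      using sublinear_scale[OF p, of c "x + t *\<^sub>R v"] c by (simp add: algebra_simps)
    finally show ?thesis using c by (simp add: field_simps)
  qed
  then have "push v p (c *\<^sub>R x) / c \<le> push v p x" by (rule push_greatest)
  then show "push v p (c *\<^sub>R x) \<le> c * push v p x" using c by (simp add: field_simps)
next
  have "0 \<le> push v p 0"
    by (rule push_greatest) (simp add: sublinear_scale[OF p])
  then show "push v p 0 = 0" using push_le[OF p, of v 0] sublinear_zero[OF p] by simp
qed

text \<open>The lower bound required by Zorn's lemma. The common majorant \<open>p\<close> keeps the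
  infimum finite, since each member is at least \<open>- p (- x)\<close> at \<open>x\<close>;
  comparability lets two members be replaced by the smaller one, which carries subadditivity over to
  the infimum.\<close>

lemma sublinear_INF_chain:
  assumes "C \<noteq> {}" and sub: "\<And>q. q \<in> C \<Longrightarrow> sublinear q" and chain: "\<And>q r. q \<in> C \<Longrightarrow> r \<in> C \<Longrightarrow> q \<le> r \<or> r \<le> q"
    and below: "\<And>q. q \<in> C \<Longrightarrow> q \<le> p"
  shows "sublinear (\<lambda>x. INF q\<in>C. q x)" "\<And>q x. q \<in> C \<Longrightarrow> (INF q\<in>C. q x) \<le> q x"
proof -
  have "- p (- x) \<le> q x" if "q \<in> C" for q x
    using sublinear_minus[OF sub[OF that], of x] below[OF that] by (smt (verit) le_funD)
  then have "bdd_below ((\<lambda>q. q x) ` C)" for x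
    by (intro bdd_belowI2[where m = "- p (- x)"])
  then show lower: "\<And>q x. q \<in> C \<Longrightarrow> (INF q\<in>C. q x) \<le> q x"
    by (rule cINF_lower)
  show "sublinear (\<lambda>x. INF q\<in>C. q x)"
  proof (rule sublinearI)
    fix x y
    have sum: "(INF q\<in>C. q (x + y)) \<le> q x + r y" if "q \<in> C" "r \<in> C" for q r
    proof -
      have "\<exists>s\<in>C. s \<le> q \<and> s \<le> r" using chain[of q r] that by auto
      then obtain s where s: "s \<in> C" "s \<le> q" "s \<le> r" by blast
      have "(INF q\<in>C. q (x + y)) \<le> s (x + y)" by (rule lower[OF s(1)])
      also have "\<dots> \<le> s x + s y" by (rule sublinear_add[OF sub[OF s(1)]])
      also have "\<dots> \<le> q x + r y" using s by (intro add_mono) (auto dest: le_funD)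
      finally show ?thesis .
    qed
    have "(INF q\<in>C. q (x + y)) - q x \<le> (INF q\<in>C. q y)" if "q \<in> C" for q
      by (rule cINF_greatest) (use assms(1) sum[OF that] in \<open>auto simp: algebra_simps\<close>)
    then have "(INF q\<in>C. q (x + y)) - (INF q\<in>C. q y) \<le> (INF q\<in>C. q x)"
      by (intro cINF_greatest) (use assms(1) in \<open>auto simp: algebra_simps\<close>)
    then show "(INF q\<in>C. q (x + y)) \<le> (INF q\<in>C. q x) + (INF q\<in>C. q y)" by simp
  next
    fix c :: real and x assume c: "0 < c"
    have "(INF q\<in>C. q (c *\<^sub>R x)) / c \<le> (INF q\<in>C. q x)"
    proof (rule cINF_greatest)
      fix q assume q: "q \<in> C"
      show "(INF q\<in>C. q (c *\<^sub>R x)) / c \<le> q x"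
        using lower[OF q, of "c *\<^sub>R x"] sublinear_scale[OF sub[OF q], of c x] c
        by (simp add: field_simps)
    qed fact
    then show "(INF q\<in>C. q (c *\<^sub>R x)) \<le> c * (INF q\<in>C. q x)" using c by (simp add: field_simps)
  next
    have "(\<lambda>q. q 0) ` C = {0::real}" using assms(1) sublinear_zero[OF sub] by force
    then show "(INF q\<in>C. q 0) = 0" by simp
  qed
qed

text \<open>A minimal sublinear functional \<open>m\<close> is linear, since \<open>m = push x m\<close> for every \<open>x\<close>; replacing
  \<open>p\<close> by \<open>push v p\<close> beforehand forces the value \<open>p v\<close> at \<open>v\<close>.\<close>

lemma Hahn_Banach_sublinear:
  fixes p :: "'a::real_vector \<Rightarrow> real"
  assumes p: "sublinear p"
  shows "\<exists>\<phi>. linear \<phi> \<and> (\<forall>x. \<phi> x \<le> p x) \<and> \<phi> v = p v"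
proof -
  let ?A = "{q. sublinear q \<and> q \<le> push v p}"
  have pv: "push v p \<in> ?A" using sublinear_push[OF p] by simp
  \<comment> \<open>Zorn's lemma for the reversed order, which yields a minimal element.\<close>
  have "\<exists>m\<in>?A. \<forall>q\<in>?A. m \<ge> q \<longrightarrow> q = m"
  proof (rule predicate_Zorn)
    show "partial_order_on ?A (relation_of (\<ge>) ?A)"
      by (rule partial_order_on_relation_ofI) auto
    fix C assume C: "C \<in> Chains (relation_of (\<ge>) ?A)"
    show "\<exists>u\<in>?A. \<forall>q\<in>C. q \<ge> u"
    \<comment> \<open>The empty chain is bounded by \<open>push v p\<close>, a nonempty one by its
      pointwise infimum.\<close>
    proof (cases "C = {}")
      case False
      have CA: "\<And>q. q \<in> C \<Longrightarrow> q \<in> ?A" and chain: "\<And>q r. q \<in> C \<Longrightarrow> r \<in> C \<Longrightarrow> q \<le> r \<or> r \<le> q"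
        using C by (auto simp: Chains_def relation_of_def)
      note INF = sublinear_INF_chain[OF False _ chain, of "push v p"]
      have "sublinear (\<lambda>x. INF q\<in>C. q x)" "\<And>q x. q \<in> C \<Longrightarrow> (INF q\<in>C. q x) \<le> q x"
        using INF CA by auto
      moreover obtain q where "q \<in> C" using False by blast
      moreover have "(\<lambda>x. INF q\<in>C. q x) \<le> push v p"
      proof (rule le_funI)
        fix x
        have "(INF q\<in>C. q x) \<le> q x" using INF CA \<open>q \<in> C\<close> by auto
        also have "\<dots> \<le> push v p x" using CA[OF \<open>q \<in> C\<close>] by (auto dest: le_funD)
        finally show "(INF q\<in>C. q x) \<le> push v p x" .
      qed
      ultimately show ?thesis by (intro bexI[where x = "\<lambda>x. INF q\<in>C. q x"]) (auto simp: le_fun_def)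
    qed (use pv in blast)
  qed
  then obtain m where m: "sublinear m" "m \<le> push v p" and min: "\<And>q. sublinear q \<Longrightarrow> q \<le> m \<Longrightarrow> q = m"
    by (auto dest: order_trans)
  have neg: "m (- x) = - m x" for x
  proof -
    \<comment> \<open>\<open>push x m\<close> is again sublinear and lies below \<open>m\<close>, so
      minimality applies; evaluating at \<open>- x\<close> makes \<open>m\<close> odd.\<close>
    have "push x m = m"
      by (intro min sublinear_push m) (simp add: le_fun_def push_le m)
    then have "m (- x) \<le> - m x" using push_minus[OF m(1), of x] by simp
    then show ?thesis using sublinear_minus[OF m(1), of x] by simp
  qed
  have le: "m x \<le> p x" for x using m(2) push_le[OF p, of v x] by (auto dest!: le_funD[of _ _ x])
  have "linear m"
  proof (rule linearI)
    fix x y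
    have "m x \<le> m (x + y) + m (- y)" using sublinear_add[OF m(1), of "x + y" "- y"] by simp
    then show "m (x + y) = m x + m y" using sublinear_add[OF m(1), of x y] by (simp add: neg)
  next
    fix c x
    show "m (c *\<^sub>R x) = c *\<^sub>R m x"
    proof (cases "0 \<le> c")
      case False
      then show ?thesis using sublinear_scale[OF m(1), of "- c" x] neg[of "c *\<^sub>R x"] by simp
    qed (simp add: sublinear_scale[OF m(1)])
  qed
  \<comment> \<open>\<open>m (- v) \<le> push v p (- v) \<le> - p v\<close> and oddness give
    \<open>p v \<le> m v\<close>.\<close>
  moreover have "m v = p v"
    using le_funD[OF m(2), of "- v"] push_minus[OF p, of v] le[of v] neg[of v] by simp
  ultimately show ?thesis using le by blast
qed

section \<open>Closed ideals of a Banach lattice\<close>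

lemma norm_pprt_le: "norm (pprt x) \<le> norm x" for x :: "'a::banach_lattice"
proof (rule norm_lattice_mono)
  show "\<bar>pprt x\<bar> \<le> \<bar>x\<bar>" by (auto simp: pprt_def abs_ge_self)
qed

lemma pprt_add_le: "pprt (x + y) \<le> pprt x + pprt y" for x y :: "'a::lattice_ab_group_add"
  unfolding pprt_def by (intro sup.boundedI add_mono) (auto intro: add_nonneg_nonneg)

lemma norm_pprt_add_le: "norm (pprt (x + y)) \<le> norm (pprt x) + norm (pprt y)" for x y :: "'a::banach_lattice"
  by (rule order_trans[OF norm_mono_nonneg norm_triangle_ineq]) (auto simp: pprt_add_le)

lemma norm_pprt_mono: "x \<le> y \<Longrightarrow> norm (pprt x) \<le> norm (pprt y)" for x y :: "'a::banach_lattice"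
  by (intro norm_mono_nonneg) auto

lemma pprt_scaleR:
  fixes x :: "'a::banach_lattice"
  assumes "0 \<le> c"
  shows "pprt (c *\<^sub>R x) = c *\<^sub>R pprt x"
proof (cases "c = 0")
  case False
  have le: "pprt (c *\<^sub>R x) \<le> c *\<^sub>R pprt x" if "0 \<le> c" for c and x :: 'a
    using that unfolding pprt_def
    by (intro sup.boundedI scaleR_left_mono scaleR_nonneg_nonneg sup_ge1 sup_ge2)
  have "pprt (inverse c *\<^sub>R (c *\<^sub>R x)) \<le> inverse c *\<^sub>R pprt (c *\<^sub>R x)"
    using assms by (intro le) simp
  then have "c *\<^sub>R pprt (inverse c *\<^sub>R (c *\<^sub>R x)) \<le> c *\<^sub>R (inverse c *\<^sub>R pprt (c *\<^sub>R x))"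
    using assms by (rule scaleR_left_mono)
  then show ?thesis using le[OF assms, of x] False by (simp add: antisym)
qed simp

lemma pprt_le_abs: "pprt x \<le> \<bar>x\<bar>" for x :: "'a::lattice_ab_group_add_abs"
  by (auto simp: pprt_def abs_ge_self)

lemma abs_scaleR_lattice: "\<bar>c *\<^sub>R x\<bar> = \<bar>c\<bar> *\<^sub>R \<bar>x\<bar>" for x :: "'a::banach_lattice"
  using modulus_scaleR[of c x 0] by simp

section \<open>Closed ideals and the closed ideal generated by one vector\<close>

lemma closed_order_interval: "closed {x :: 'a::banach_lattice. a \<le> x \<and> x \<le> b}"
  unfolding closed_sequential_limits by (auto intro: le_limit[OF tendsto_const] le_limit[OF _ tendsto_const])

lemma
  fixes I :: "'a::banach_lattice set"
  assumes "closed_ideal scaleR I"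
  shows closed_ideal_subspace: "subspace I"
    and closed_ideal_solid: "y \<in> I \<Longrightarrow> \<bar>x\<bar> \<le> \<bar>y\<bar> \<Longrightarrow> x \<in> I"
    and closed_ideal_closed: "closed I"
    and closed_ideal_zero: "0 \<in> I"
  using assms unfolding closed_ideal_def subspace_raw_def[symmetric] by (auto intro: subspace_0)

lemma closed_ideal_abs_iff: "closed_ideal scaleR I \<Longrightarrow> \<bar>x\<bar> \<in> I \<longleftrightarrow> x \<in> I"
  for I :: "'a::banach_lattice set"
  using closed_ideal_solid[of I x "\<bar>x\<bar>"] closed_ideal_solid[of I "\<bar>x\<bar>" x] by auto

lemma closed_ideal_between:
  fixes I :: "'a::banach_lattice set"
  shows "closed_ideal scaleR I \<Longrightarrow> y \<in> I \<Longrightarrow> 0 \<le> x \<Longrightarrow> x \<le> y \<Longrightarrow> x \<in> I"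
  by (rule closed_ideal_solid[of I y x]) (auto intro: order_trans)

lemma closed_idealI:
  fixes I :: "'a::banach_lattice set"
  assumes "subspace I" "\<And>x y. y \<in> I \<Longrightarrow> \<bar>x\<bar> \<le> \<bar>y\<bar> \<Longrightarrow> x \<in> I" "closed I"
  shows "closed_ideal scaleR I"
  using assms unfolding closed_ideal_def subspace_raw_def[symmetric] by blast

lemma closed_ideal_trivial: "closed_ideal scaleR {0 :: 'a::banach_lattice}"
  by (rule closed_idealI) (auto simp: subspace_def)

lemma in_closedI:
  fixes I :: "'a::real_normed_vector set"
  assumes "closed I" "\<And>e. 0 < e \<Longrightarrow> \<exists>y\<in>I. norm (x - y) < e"
  shows "x \<in> I"
  using assms closed_approachable[of I x] by (metis dist_commute dist_norm)

text \<open>The closed ideal generated by \<open>h \<ge> 0\<close>: \<open>(\<bar>x\<bar> - c h)\<^sup>+\<close> is what remains of \<open>\<bar>x\<bar>\<close> after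
  truncation at \<open>c h\<close>.\<close>

definition principal_closed_ideal :: "'a::banach_lattice \<Rightarrow> 'a set" where
  "principal_closed_ideal h = {x. \<forall>e>0. \<exists>c\<ge>0. norm (pprt (\<bar>x\<bar> - c *\<^sub>R h)) < e}"

lemma principal_closed_idealI_le:
  assumes "\<bar>x\<bar> \<le> c *\<^sub>R h" "0 \<le> c"
  shows "x \<in> principal_closed_ideal h"
  using assms unfolding principal_closed_ideal_def by (auto intro!: exI[of _ c])

text \<open>Each property is read off the truncation error: the constants add up for a sum and are
  multiplied by \<open>\<bar>a\<bar>\<close> for a multiple, while domination keeps the constant and
  a limit can use that of a nearby \<open>X n\<close>.\<close>

lemma closed_ideal_principal:
  fixes h :: "'a::banach_lattice"
  assumes h: "0 \<le> h"
  shows "closed_ideal scaleR (principal_closed_ideal h)"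
proof (rule closed_idealI)
  let ?P = "principal_closed_ideal h"
  show "subspace ?P"
  proof (rule subspaceI)
    show "0 \<in> ?P" by (rule principal_closed_idealI_le[of _ 0]) auto
  next
    fix x y assume x: "x \<in> ?P" and y: "y \<in> ?P"
    show "x + y \<in> ?P"
      unfolding principal_closed_ideal_def
    proof (intro CollectI allI impI)
      fix e :: real assume "0 < e"
      then obtain c d where c: "0 \<le> c" "norm (pprt (\<bar>x\<bar> - c *\<^sub>R h)) < e / 2"
        and d: "0 \<le> d" "norm (pprt (\<bar>y\<bar> - d *\<^sub>R h)) < e / 2"
        using x y half_gt_zero[of e] unfolding principal_closed_ideal_def by blast
      have "\<bar>x + y\<bar> - (c + d) *\<^sub>R h \<le> (\<bar>x\<bar> - c *\<^sub>R h) + (\<bar>y\<bar> - d *\<^sub>R h)"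
        using abs_triangle_ineq[of x y] by (simp add: algebra_simps)
      from norm_pprt_mono[OF this] norm_pprt_add_le[of "\<bar>x\<bar> - c *\<^sub>R h" "\<bar>y\<bar> - d *\<^sub>R h"]
      have "norm (pprt (\<bar>x + y\<bar> - (c + d) *\<^sub>R h)) < e" using c d by linarith
      then show "\<exists>c\<ge>0. norm (pprt (\<bar>x + y\<bar> - c *\<^sub>R h)) < e"
        using c d by (intro exI[of _ "c + d"]) simp
    qed
  next
    fix a :: real and x assume x: "x \<in> ?P"
    show "a *\<^sub>R x \<in> ?P"
      unfolding principal_closed_ideal_def
    proof (intro CollectI allI impI)
      fix e :: real assume "0 < e"
      \<comment> \<open>The summand 1 covers \<open>a = 0\<close>.\<close>
      then have "0 < e / (\<bar>a\<bar> + 1)" by simp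
      then obtain c where c: "0 \<le> c" "norm (pprt (\<bar>x\<bar> - c *\<^sub>R h)) < e / (\<bar>a\<bar> + 1)"
        using x unfolding principal_closed_ideal_def by blast
      have "pprt (\<bar>a *\<^sub>R x\<bar> - (\<bar>a\<bar> * c) *\<^sub>R h) = \<bar>a\<bar> *\<^sub>R pprt (\<bar>x\<bar> - c *\<^sub>R h)"
        by (subst pprt_scaleR[symmetric]) (auto simp: abs_scaleR_lattice scaleR_right_diff_distrib)
      then have "norm (pprt (\<bar>a *\<^sub>R x\<bar> - (\<bar>a\<bar> * c) *\<^sub>R h)) \<le> (\<bar>a\<bar> + 1) * norm (pprt (\<bar>x\<bar> - c *\<^sub>R h))"
        by (simp add: mult_right_mono)
      also have "\<dots> < e" using c(2) by (simp add: field_simps)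
      finally show "\<exists>c\<ge>0. norm (pprt (\<bar>a *\<^sub>R x\<bar> - c *\<^sub>R h)) < e"
        using c(1) by (intro exI[of _ "\<bar>a\<bar> * c"]) simp
    qed
  qed
  show "x \<in> ?P" if "y \<in> ?P" "\<bar>x\<bar> \<le> \<bar>y\<bar>" for x y
  proof -
    have "norm (pprt (\<bar>x\<bar> - c *\<^sub>R h)) \<le> norm (pprt (\<bar>y\<bar> - c *\<^sub>R h))" for c
      using that(2) by (intro norm_pprt_mono) simp
    then show ?thesis using that(1) unfolding principal_closed_ideal_def
      by (blast intro: le_less_trans)
  qed
  show "closed ?P"
    unfolding closed_sequential_limits
  proof (intro allI impI, elim conjE)
    fix X x assume X: "\<forall>n. X n \<in> ?P" "X \<longlonglongrightarrow> x"
    show "x \<in> ?P"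
      unfolding principal_closed_ideal_def
    proof (intro CollectI allI impI)
      fix e :: real assume "0 < e"
      then obtain n where n: "norm (X n - x) < e / 2"
        using X(2) unfolding LIMSEQ_iff by (meson half_gt_zero order_refl)
      obtain c where c: "0 \<le> c" "norm (pprt (\<bar>X n\<bar> - c *\<^sub>R h)) < e / 2"
        using X(1) half_gt_zero[of e] \<open>0 < e\<close> unfolding principal_closed_ideal_def by blast
      have "\<bar>x\<bar> - c *\<^sub>R h \<le> (\<bar>X n\<bar> - c *\<^sub>R h) + \<bar>x - X n\<bar>"
        using abs_triangle_ineq[of "X n" "x - X n"] by (simp add: algebra_simps)
      from norm_pprt_mono[OF this] norm_pprt_add_le[of "\<bar>X n\<bar> - c *\<^sub>R h" "\<bar>x - X n\<bar>"]
      have "norm (pprt (\<bar>x\<bar> - c *\<^sub>R h)) < e"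
        using c n by (simp add: norm_abs_lattice norm_minus_commute)
      then show "\<exists>c\<ge>0. norm (pprt (\<bar>x\<bar> - c *\<^sub>R h)) < e" using c by blast
    qed
  qed
qed

text \<open>Turns the truncation error into the distance from \<open>x\<close> to the concrete
  approximant \<open>inf x y\<close>.\<close>

lemma pprt_diff_eq: "pprt (x - y) = x - inf x y" for x y :: "'a::lattice_ab_group_add"
proof -
  have "x - inf x y = x + sup (- x) (- y)" by simp
  also have "\<dots> = sup 0 (x - y)" by (simp add: add_sup_distrib_left)
  finally show ?thesis by (simp add: pprt_def sup_commute)
qed

lemma principal_closed_ideal_approx:
  fixes h :: "'a::banach_lattice"
  assumes "x \<in> principal_closed_ideal h" "0 \<le> x" "0 \<le> h" "0 < e"
  shows "\<exists>c\<ge>0. \<exists>y\<ge>0. y \<le> c *\<^sub>R h \<and> norm (x - y) < e"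
proof -
  obtain c where c: "0 \<le> c" "norm (pprt (x - c *\<^sub>R h)) < e"
    using assms unfolding principal_closed_ideal_def by (auto simp: abs_of_nonneg)
  then have "norm (x - inf x (c *\<^sub>R h)) < e" by (simp only: pprt_diff_eq)
  moreover have "0 \<le> inf x (c *\<^sub>R h)"
    using assms c(1) by (intro le_infI scaleR_nonneg_nonneg)
  ultimately show ?thesis using c(1) inf_le2[of x "c *\<^sub>R h"] by blast
qed

text \<open>The order interval \<open>[0, h]\<close> spans a dense subspace of the ideal: positive
  elements are limits of elements of some \<open>[0, c h]\<close>, which are multiples of elements
  of \<open>[0, h]\<close>, and every element is a difference of positive ones.\<close>

lemma principal_closed_ideal_subset:
  fixes h :: "'a::banach_lattice"
  assumes h: "0 \<le> h" and V: "subspace V" "closed V" and le: "\<And>y. 0 \<le> y \<Longrightarrow> y \<le> h \<Longrightarrow> y \<in> V"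
  shows "principal_closed_ideal h \<subseteq> V"
proof
  fix x assume x: "x \<in> principal_closed_ideal h"
  have pos: "z \<in> V" if z: "z \<in> principal_closed_ideal h" "0 \<le> z" for z
  proof (rule in_closedI[OF V(2)])
    fix e :: real assume "0 < e"
    then obtain c y where y: "0 \<le> c" "0 \<le> y" "y \<le> c *\<^sub>R h" "norm (z - y) < e"
      using principal_closed_ideal_approx[OF z h] by blast
    have "y \<in> V"
    proof (cases "c = 0")
      case True
      then show ?thesis using y V(1) by (simp add: subspace_0)
    next
      case False
      have "inverse c *\<^sub>R y \<le> inverse c *\<^sub>R (c *\<^sub>R h)" using y by (intro scaleR_left_mono) auto
      then have "inverse c *\<^sub>R y \<in> V"
        using y False by (intro le scaleR_nonneg_nonneg) simp_all
      then have "c *\<^sub>R (inverse c *\<^sub>R y) \<in> V" using V(1) by (rule subspace_scale[rotated])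
      then show ?thesis using False by simp
    qed
    then show "\<exists>y\<in>V. norm (z - y) < e" using y by blast
  qed
  have P: "closed_ideal scaleR (principal_closed_ideal h)" by (rule closed_ideal_principal[OF h])
  have "pprt x \<in> V" "pprt (- x) \<in> V"
    using pprt_le_abs[of x] pprt_le_abs[of "- x"] closed_ideal_abs_iff[OF P, of x] x
    by (auto intro!: pos intro: closed_ideal_between[OF P])
  then have "pprt x - pprt (- x) \<in> V" using V(1) by (rule subspace_diff[rotated])
  then show "x \<in> V" by (metis diff_minus_eq_add prts pprt_neg)
qed

section \<open>Positive functionals and their separation from closed ideals\<close>

lemma
  assumes "pos_functional scaleR (\<phi> :: 'a::banach_lattice \<Rightarrow> real)"
  shows pos_functional_bounded_linear: "bounded_linear \<phi>"
    and pos_functional_nonneg: "0 \<le> f \<Longrightarrow> 0 \<le> \<phi> f"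
proof -
  have "(*) = (scaleR :: real \<Rightarrow> real \<Rightarrow> real)" by (simp add: fun_eq_iff)
  then show "bounded_linear \<phi>"
    using assms by (simp add: pos_functional_def dual_def bounded_operator_scaleR)
  show "0 \<le> f \<Longrightarrow> 0 \<le> \<phi> f"
    using assms unfolding pos_functional_def by (metis nonneg_Reals_cases of_real_eq_id id_apply)
qed

lemma pos_functionalI:
  assumes "bounded_linear (\<phi> :: 'a::banach_lattice \<Rightarrow> real)" "\<And>f. 0 \<le> f \<Longrightarrow> 0 \<le> \<phi> f"
  shows "pos_functional scaleR \<phi>"
proof -
  have "(*) = (scaleR :: real \<Rightarrow> real \<Rightarrow> real)" by (simp add: fun_eq_iff)
  moreover have "(r::real) \<in> \<real>\<^sub>\<ge>\<^sub>0" if "0 \<le> r" for r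
    using nonneg_Reals_of_real_iff[of r, where 'a = real] that by simp
  ultimately show ?thesis
    using assms by (simp add: pos_functional_def dual_def bounded_operator_scaleR)
qed

text \<open>The separating functional comes from Hahn--Banach applied to the asymmetric distance
  \<open>p x = inf {\<parallel>(x - y)\<^sup>+\<parallel> | y \<in> I}\<close>, which vanishes on \<open>I\<close> and on the negative cone.\<close>

lemma closed_ideal_separation:
  fixes I :: "'a::banach_lattice set"
  assumes I: "closed_ideal scaleR I" and "I \<noteq> UNIV"
  shows "\<exists>\<phi>. pos_functional scaleR \<phi> \<and> \<phi> \<noteq> (\<lambda>_. 0) \<and> (\<forall>x\<in>I. \<phi> x = 0)"
proof -
  define p where "p x = (INF y\<in>I. norm (pprt (x - y)))" for x
  note sub = closed_ideal_subspace[OF I]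
  have I0: "0 \<in> I" using sub by (rule subspace_0)
  have lower: "p x \<le> norm (pprt (x - y))" if "y \<in> I" for x y
    unfolding p_def by (rule cINF_lower) (use that in \<open>auto intro!: bdd_belowI2[where m = 0]\<close>)
  have greatest: "b \<le> p x" if "\<And>y. y \<in> I \<Longrightarrow> b \<le> norm (pprt (x - y))" for b x
    unfolding p_def by (rule cINF_greatest) (use that I0 in auto)
  have p0: "0 \<le> p x" for x by (rule greatest) simp
  have pI: "p x = 0" if "x \<in> I" for x using lower[OF that, of x] p0[of x] by simp
  have p: "sublinear p"
  proof (rule sublinearI)
    fix x y
    have sum: "p (x + y) \<le> norm (pprt (x - u)) + norm (pprt (y - v))" if "u \<in> I" "v \<in> I" for u v
      using lower[OF subspace_add[OF sub that], of "x + y"] norm_pprt_add_le[of "x - u" "y - v"]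
      by (simp add: algebra_simps)
    have "p (x + y) - norm (pprt (x - u)) \<le> p y" if "u \<in> I" for u
      by (rule greatest) (use sum[OF that] in \<open>simp add: algebra_simps\<close>)
    then have "p (x + y) - p y \<le> p x"
      by (intro greatest) (simp add: algebra_simps)
    then show "p (x + y) \<le> p x + p y" by simp
  next
    fix c :: real and x assume c: "0 < c"
    have "p (c *\<^sub>R x) / c \<le> p x"
    proof (rule greatest)
      fix y assume "y \<in> I"
      then have "p (c *\<^sub>R x) \<le> norm (pprt (c *\<^sub>R x - c *\<^sub>R y))"
        by (intro lower subspace_scale[OF sub])
      also have "\<dots> = c * norm (pprt (x - y))"
        using c by (simp add: pprt_scaleR flip: scaleR_right_diff_distrib)
      finally show "p (c *\<^sub>R x) / c \<le> norm (pprt (x - y))" using c by (simp add: field_simps)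
    qed
    then show "p (c *\<^sub>R x) \<le> c * p x" using c by (simp add: field_simps)
  qed (rule pI[OF I0])
  obtain x where "x \<notin> I" using assms(2) by blast
  then have v: "0 \<le> \<bar>x\<bar>" "\<bar>x\<bar> \<notin> I" using closed_ideal_abs_iff[OF I] by auto
  obtain \<phi> where \<phi>: "linear \<phi>" "\<And>x. \<phi> x \<le> p x" "\<phi> \<bar>x\<bar> = p \<bar>x\<bar>"
    using Hahn_Banach_sublinear[OF p, of "\<bar>x\<bar>"] by blast
  \<comment> \<open>Asymmetric distance zero would force membership in the closed set
    \<open>I\<close>, although \<open>\<bar>x\<bar>\<close> lies outside it.\<close>
  have "p \<bar>x\<bar> \<noteq> 0"
  proof
    assume eq: "p \<bar>x\<bar> = 0"
    have "\<bar>x\<bar> \<in> I"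
    proof (rule in_closedI[OF closed_ideal_closed[OF I]])
      fix e :: real assume "0 < e"
      then obtain y where y: "y \<in> I" "norm (pprt (\<bar>x\<bar> - y)) < e"
        using eq greatest[of e "\<bar>x\<bar>"] by (metis not_less)
      \<comment> \<open>The truncation of \<open>\<bar>x\<bar>\<close> at \<open>y\<close>, cut off
        below at 0 because \<open>y\<close> need not be positive. It lies between 0 and
        \<open>\<bar>y\<bar>\<close>, hence in \<open>I\<close>, and
        \<open>\<bar>x\<bar> - ?z\<close> lies between 0 and
        \<open>pprt (\<bar>x\<bar> - y)\<close>.\<close>
      let ?z = "pprt (inf \<bar>x\<bar> y)"
      have "?z \<le> \<bar>y\<bar>" by (auto simp: pprt_def intro: le_infI2 abs_ge_self)
      then have "?z \<in> I" using y(1) closed_ideal_abs_iff[OF I, of y]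
        by (auto intro: closed_ideal_between[OF I])
      moreover have "norm (\<bar>x\<bar> - ?z) \<le> norm (pprt (\<bar>x\<bar> - y))"
        unfolding pprt_diff_eq
        by (rule norm_mono_nonneg) (auto simp: pprt_def simp del: diff_inf_eq_sup diff_sup_eq_inf)
      ultimately show "\<exists>y\<in>I. norm (\<bar>x\<bar> - y) < e" using y(2) by (intro bexI[of _ ?z]) auto
    qed
    then show False using v by simp
  qed
  \<comment> \<open>Choosing 0 in the infimum gives \<open>p x \<le> norm (pprt x)\<close>. Together
    with \<open>\<phi> \<le> p\<close> this bounds \<open>\<phi> x\<close> by \<open>norm x\<close>
    and makes \<open>\<phi>\<close> nonpositive on the negative cone.\<close>
  moreover have "pos_functional scaleR \<phi>"
  proof (rule pos_functionalI)
    have "\<phi> x \<le> norm x" for x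
      using \<phi>(2)[of x] lower[OF I0, of x] norm_pprt_le[of x] by simp
    from this this[of "- x" for x] have "\<bar>\<phi> x\<bar> \<le> norm x" for x
      using linear_neg[OF \<phi>(1), of x] by (smt (verit) norm_minus_cancel)
    then show "bounded_linear \<phi>"
      using \<phi>(1) by (intro bounded_linear.intro bounded_linear_axioms.intro exI[of _ 1]) auto
    show "0 \<le> \<phi> f" if "0 \<le> f" for f
      using \<phi>(2)[of "- f"] lower[OF I0, of "- f"] linear_neg[OF \<phi>(1), of f] that by simp
  qed
  moreover have "\<phi> x = 0" if "x \<in> I" for x
    using \<phi>(2)[of x] \<phi>(2)[of "- x"] pI[OF that] pI[OF subspace_neg[OF sub that]]
      linear_neg[OF \<phi>(1), of x] by simp
  ultimately show ?thesis using \<phi>(3) by (intro exI[of _ \<phi>]) (auto dest: fun_cong)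
qed

section \<open>Eventually positive semigroups on real Banach lattices\<close>

lemma
  assumes "C0_semigroup scaleR T"
  shows C0_semigroup_bounded_linear: "0 \<le> t \<Longrightarrow> bounded_linear (T t)"
    and C0_semigroup_zero: "T 0 f = f"
    and C0_semigroup_add: "0 \<le> s \<Longrightarrow> 0 \<le> t \<Longrightarrow> T (s + t) f = T s (T t f)"
    and C0_semigroup_tendsto: "((\<lambda>t. T t f) \<longlongrightarrow> f) (at_right 0)"
  using assms by (auto simp: C0_semigroup_def bounded_operator_scaleR)

text \<open>Strong continuity at 0, applied to the vector \<open>T t f\<close>, makes the orbit
  right-continuous at \<open>t\<close>, so times approaching \<open>t\<close> from the right decide
  membership in a closed set.\<close>

lemma orbit_mem_closed:
  assumes T: "C0_semigroup scaleR T" and V: "closed V" and t: "0 \<le> t"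
    and dense: "\<And>e. 0 < e \<Longrightarrow> \<exists>s. 0 < s \<and> s < e \<and> T (t + s) f \<in> V"
  shows "T t f \<in> V"
proof (rule in_closedI[OF V])
  fix e :: real assume "0 < e"
  then have "\<forall>\<^sub>F s in at_right 0. dist (T s (T t f)) (T t f) < e"
    by (rule tendstoD[OF C0_semigroup_tendsto[OF T]])
  then obtain b where b: "0 < b" "\<And>s. 0 < s \<Longrightarrow> s < b \<Longrightarrow> dist (T s (T t f)) (T t f) < e"
    unfolding eventually_at_right_field by auto
  obtain s where s: "0 < s" "s < b" "T (t + s) f \<in> V" using dense[OF b(1)] by blast
  have "T (t + s) f = T s (T t f)"
    using C0_semigroup_add[OF T, of s t] s t by (simp add: add.commute)
  then show "\<exists>y\<in>V. norm (T t f - y) < e"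
    using b(2)[OF s(1,2)] s(3) by (intro bexI[of _ "T (t + s) f"]) (auto simp: dist_norm norm_minus_commute)
qed

text \<open>The Baire step. It is used with \<open>J\<close> the closed ideal generated by
  \<open>h\<close>, to obtain eventual invariance, and with \<open>J = {0}\<close>, to obtain
  nilpotency.\<close>

lemma eventually_into_ideal_uniform:
  fixes T :: "real \<Rightarrow> 'a::banach_lattice \<Rightarrow> 'a"
  assumes T: "C0_semigroup scaleR T" and pos: "indiv_eventually_positive T"
    and J: "closed_ideal scaleR J" and h: "0 \<le> h" and into: "\<And>t. t\<^sub>1 \<le> t \<Longrightarrow> T t h \<in> J"
  shows "\<exists>t\<^sub>0\<ge>0. \<forall>t\<ge>t\<^sub>0. T t ` principal_closed_ideal h \<subseteq> J"
proof -
  define K where "K = {x. 0 \<le> x \<and> x \<le> h}"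
  define C where "C n = {x. \<forall>t\<ge>real n. T t x \<in> J}" for n
  have lin: "linear (T t)" if "real n \<le> t" for n t
    using C0_semigroup_bounded_linear[OF T, of t] that by (auto intro: bounded_linear.linear)
  have sub: "subspace (C n)" for n
    using closed_ideal_subspace[OF J] lin
    by (auto simp: subspace_def C_def linear_0 linear_add linear_scale)
  have closed: "closed (C n)" for n
  proof -
    have "C n = (\<Inter>t\<in>{real n..}. T t -` J)" by (auto simp: C_def)
    moreover have "closed (T t -` J)" if "t \<in> {real n..}" for t
      using C0_semigroup_bounded_linear[OF T, of t] that
      by (intro continuous_closed_vimage closed_ideal_closed[OF J]) (auto intro: linear_continuous_at)
    ultimately show ?thesis by auto
  qed
  have cover: "K \<subseteq> (\<Union>n. C n)"
  proof
    fix x assume "x \<in> K"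
    then have x: "0 \<le> x" "0 \<le> h - x" by (auto simp: K_def)
    obtain a where a: "\<And>t. a \<le> t \<Longrightarrow> 0 \<le> T t x"
      using pos x(1) unfolding indiv_eventually_positive_def by blast
    obtain b where b: "\<And>t. b \<le> t \<Longrightarrow> 0 \<le> T t (h - x)"
      using pos x(2) unfolding indiv_eventually_positive_def by blast
    \<comment> \<open>Beyond this time both \<open>T t x\<close> and \<open>T t (h - x)\<close> are
      positive and \<open>T t h\<close> is in \<open>J\<close>, so \<open>T t x\<close> is squeezed
      between 0 and an element of \<open>J\<close>.\<close>
    obtain n where n: "max (max a b) t\<^sub>1 \<le> real n" using real_arch_simple by blast
    have "T t x \<in> J" if t: "real n \<le> t" for t
    proof (rule closed_ideal_between[OF J])
      show "T t h \<in> J" using t n by (intro into) simp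
      show "0 \<le> T t x" using t n by (intro a) simp
      show "T t x \<le> T t h" using b[of t] t n by (simp add: linear_diff[OF lin[OF t]])
    qed
    then show "x \<in> (\<Union>n. C n)" by (auto simp: C_def)
  qed
  have "K \<noteq> {}" using h by (auto simp: K_def)
  with closed_cover_has_interior[OF _ _ closed cover] obtain n x r
    where x: "x \<in> K" "0 < r" "ball x r \<inter> K \<subseteq> C n"
    using closed_order_interval[of 0 h] unfolding K_def by metis
  have xC: "x \<in> C n" using x by auto
  have "y \<in> C n" if y: "0 \<le> y" "y \<le> h" for y
  proof -
    \<comment> \<open>A step from \<open>x\<close> towards \<open>y\<close> that stays within
      distance \<open>r\<close> of \<open>x\<close>; the summand 1 covers \<open>y = x\<close>, and
      \<open>e \<le> 1\<close> keeps the point \<open>z\<close> in the convex set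
      \<open>K\<close>.\<close>
    define e where "e = min 1 (r / (2 * (norm (y - x) + 1)))"
    have e: "0 < e" "e \<le> 1" using x(2) by (auto simp: e_def add_nonneg_pos)
    have "e * norm (y - x) \<le> r / (2 * (norm (y - x) + 1)) * norm (y - x)"
      by (intro mult_right_mono) (auto simp: e_def)
    also have "\<dots> < r" using x(2) by (simp add: divide_simps) (smt (verit) mult_nonneg_nonneg norm_ge_zero)
    finally have dist: "e * norm (y - x) < r" .
    define z where "z = (1 - e) *\<^sub>R x + e *\<^sub>R y"
    have zx: "z - x = e *\<^sub>R (y - x)" by (simp add: z_def algebra_simps)
    have "norm (z - x) < r" using dist e(1) by (simp add: zx)
    then have "z \<in> ball x r" by (simp add: dist_norm norm_minus_commute)
    moreover have "z \<in> K"
    proof -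
      have "0 \<le> z" unfolding z_def using e x(1) y
        by (intro add_nonneg_nonneg scaleR_nonneg_nonneg) (auto simp: K_def)
      moreover have "z \<le> (1 - e) *\<^sub>R h + e *\<^sub>R h" unfolding z_def using e x(1) y
        by (intro add_mono scaleR_left_mono) (auto simp: K_def)
      ultimately show ?thesis by (simp add: K_def algebra_simps)
    qed
    ultimately have "z \<in> C n" using x(3) by blast
    \<comment> \<open>The subspace \<open>C n\<close> contains \<open>x\<close> and
      \<open>z\<close>, so it contains \<open>y\<close> on the line through them.\<close>
    then have "z - x \<in> C n" using xC by (intro subspace_diff[OF sub])
    then have "inverse e *\<^sub>R (z - x) \<in> C n" by (rule subspace_scale[OF sub])
    then have "y - x \<in> C n" using e by (simp add: zx)
    then have "(y - x) + x \<in> C n" using xC by (intro subspace_add[OF sub])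
    then show ?thesis by simp
  qed
  then have "principal_closed_ideal h \<subseteq> C n"
    by (intro principal_closed_ideal_subset h sub closed)
  then show ?thesis by (intro exI[of _ "real n"]) (auto simp: C_def)
qed

section \<open>Banach lattices with only trivial closed ideals\<close>

text \<open>With u = x^+ and v = x^-, the truncation identity reads u - inf u v = (u - v)^+ = x^+ =
  u.\<close>

lemma pprt_disjoint: "inf (pprt x) (pprt (- x)) = 0" for x :: "'a::lattice_ab_group_add"
proof -
  have "pprt x - inf (pprt x) (pprt (- x)) = pprt (pprt x - pprt (- x))"
    by (simp only: pprt_diff_eq)
  also have "pprt x - pprt (- x) = x" by (metis diff_minus_eq_add prts pprt_neg)
  finally have "pprt x - inf (pprt x) (pprt (- x)) = pprt x - 0" by (simp only: diff_0_right)
  then show ?thesis by (simp only: diff_left_imp_eq)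
qed

lemma archimedean_le_zero:
  fixes f y :: "'a::banach_lattice"
  assumes "\<And>n. real (Suc n) *\<^sub>R f \<le> y"
  shows "f \<le> 0"
proof -
  have "f \<le> inverse (real (Suc n)) *\<^sub>R y" for n
    using assms[of n] by (subst pos_le_divideR_eq) simp_all
  then have "f \<le> 0 *\<^sub>R y"
    by (rule le_limit[OF tendsto_const tendsto_scaleR[OF LIMSEQ_inverse_real_of_nat tendsto_const]])
  then show ?thesis by simp
qed

text \<open>If x^+ is nonzero, the closed ideal it generates is everything and so contains x^-. But
  x^- is disjoint from every multiple of x^+, so truncation leaves it unchanged, and its norm is
  below every e > 0.\<close>

lemma trivial_closed_ideals_total:
  fixes x :: "'a::banach_lattice"
  assumes triv: "\<And>I :: 'a set. closed_ideal scaleR I \<Longrightarrow> I = {0} \<or> I = UNIV"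
  shows "0 \<le> x \<or> x \<le> 0"
proof (cases "pprt x = 0")
  case False
  let ?u = "pprt x" and ?v = "pprt (- x)"
  have "?u \<in> principal_closed_ideal ?u" by (rule principal_closed_idealI_le[of _ 1]) simp_all
  then have "principal_closed_ideal ?u = UNIV"
    using triv[OF closed_ideal_principal, of ?u] False by auto
  then have v: "?v \<in> principal_closed_ideal ?u" by simp
  have "norm ?v < e" if "0 < e" for e
  proof -
    obtain c where c: "0 \<le> c" "norm (pprt (?v - c *\<^sub>R ?u)) < e"
      using v \<open>0 < e\<close> unfolding principal_closed_ideal_def by (auto simp: abs_of_nonneg)
    \<comment> \<open>One factor dominating both 1 and \<open>c\<close>: then \<open>?w\<close> lies
      below \<open>d\<close> times \<open>?u\<close> and \<open>d\<close> times \<open>?v\<close>,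
      hence below \<open>d\<close> times their infimum 0.\<close>
    define d where "d = max 1 c"
    let ?w = "inf ?v (c *\<^sub>R ?u)"
    have d: "0 < d" by (simp add: d_def)
    have "?w \<le> 1 *\<^sub>R ?v" by simp
    also have "\<dots> \<le> d *\<^sub>R ?v" by (intro scaleR_right_mono) (auto simp: d_def)
    finally have wv: "?w \<le> d *\<^sub>R ?v" .
    have "?w \<le> c *\<^sub>R ?u" by simp
    also have "\<dots> \<le> d *\<^sub>R ?u" by (intro scaleR_right_mono) (auto simp: d_def)
    finally have wu: "?w \<le> d *\<^sub>R ?u" .
    have "inverse d *\<^sub>R ?w \<le> inverse d *\<^sub>R (d *\<^sub>R ?u)" "inverse d *\<^sub>R ?w \<le> inverse d *\<^sub>R (d *\<^sub>R ?v)"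
      using wu wv d by (intro scaleR_left_mono; simp)+
    then have "inverse d *\<^sub>R ?w \<le> inf ?u ?v" using d by simp
    then have "d *\<^sub>R (inverse d *\<^sub>R ?w) \<le> d *\<^sub>R 0"
      unfolding pprt_disjoint using d by (intro scaleR_left_mono) auto
    then have "?w \<le> 0" using d by simp
    moreover have "0 \<le> ?w" using c(1) by (intro le_infI scaleR_nonneg_nonneg zero_le_pprt)
    ultimately have "?w = 0" by (rule antisym)
    then have "pprt (?v - c *\<^sub>R ?u) = ?v" unfolding pprt_diff_eq by (simp only: diff_0_right)
    then show ?thesis using c(2) by (simp only:)
  qed
  then have "?v = 0" by (metis less_irrefl zero_less_norm_iff)
  then have "- x \<le> 0" by (simp only: le_zero_iff_zero_pprt)
  then show ?thesis by simp
qed (simp add: le_zero_iff_zero_pprt)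

text \<open>By totality the scalars with \<open>c *\<^sub>R f \<le> x\<close> and those with
  \<open>x \<le> c *\<^sub>R f\<close> cover the real line. Both sets are closed, and nonempty by
  the Archimedean property, so connectedness makes them meet.\<close>

lemma trivial_closed_ideals_line:
  fixes f x :: "'a::banach_lattice"
  assumes triv: "\<And>I :: 'a set. closed_ideal scaleR I \<Longrightarrow> I = {0} \<or> I = UNIV"
    and f: "0 \<le> f" "f \<noteq> 0"
  shows "\<exists>c. x = c *\<^sub>R f"
proof -
  define A B where "A = {c. c *\<^sub>R f \<le> x}" and "B = {c. x \<le> c *\<^sub>R f}"
  have cover: "c \<in> A \<or> c \<in> B" for c
    using trivial_closed_ideals_total[OF triv, of "x - c *\<^sub>R f"] by (auto simp: A_def B_def)
  have "closed A" "closed B"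
  proof -
    have lim: "(\<lambda>n. X n *\<^sub>R f) \<longlonglongrightarrow> c *\<^sub>R f" if "X \<longlonglongrightarrow> c" for X c
      using that by (intro tendsto_intros)
    show "closed A"
      unfolding closed_sequential_limits A_def using le_limit[OF lim tendsto_const] by blast
    show "closed B"
      unfolding closed_sequential_limits B_def using le_limit[OF tendsto_const lim] by blast
  qed
  moreover have "A \<noteq> {}"
  proof
    assume "A = {}"
    then have "- real (Suc n) \<in> B" for n using cover by blast
    then have "real (Suc n) *\<^sub>R f \<le> - x" for n
      unfolding B_def by (metis mem_Collect_eq le_minus_iff scaleR_minus_left)
    then show False using f archimedean_le_zero[of f "- x"] by (simp add: antisym)
  qed
  moreover have "B \<noteq> {}"
  proof
    assume "B = {}"
    then have "real (Suc n) \<in> A" for n using cover by blast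
    then have "real (Suc n) *\<^sub>R f \<le> x" for n by (simp add: A_def)
    then show False using f archimedean_le_zero[of f x] by (simp add: antisym)
  qed
  moreover have "UNIV \<subseteq> A \<union> B" using cover by blast
  ultimately have "A \<inter> B \<noteq> {}"
    using connected_UNIV[where 'a = real] unfolding connected_closed
    by (metis Int_UNIV_right)
  then show ?thesis unfolding A_def B_def by (blast intro: antisym)
qed

text \<open>If \<open>f\<close> were nonzero, it would span the space, so T s f = c f and T (2 s) f
  = c^2 f. Vanishing at \<open>t\<close> thus passes to t/2, t/4 and so on, against strong
  continuity at 0.\<close>

lemma nilpotent_imp_zero:
  fixes T :: "real \<Rightarrow> 'a::banach_lattice \<Rightarrow> 'a"
  assumes T: "C0_semigroup scaleR T"
    and triv: "\<And>I :: 'a set. closed_ideal scaleR I \<Longrightarrow> I = {0} \<or> I = UNIV"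
    and f: "0 \<le> f" and t: "0 < t" "T t f = 0"
  shows "f = 0"
proof (rule ccontr)
  assume "f \<noteq> 0"
  have "T (t / 2 ^ k) f = 0" for k
  proof (induction k)
    case (Suc k)
    let ?s = "t / 2 ^ Suc k"
    have s: "0 \<le> ?s" using t by simp
    obtain c where c: "T ?s f = c *\<^sub>R f"
      using trivial_closed_ideals_line[OF triv f \<open>f \<noteq> 0\<close>] by blast
    have "T (?s + ?s) f = c *\<^sub>R c *\<^sub>R f"
      using C0_semigroup_add[OF T s s] linear_scale[OF bounded_linear.linear[OF C0_semigroup_bounded_linear[OF T s]]]
      by (simp only: c)
    moreover have "?s + ?s = t / 2 ^ k" by simp
    ultimately have "c *\<^sub>R c *\<^sub>R f = 0" using Suc by (simp only:)
    then show ?case using c \<open>f \<noteq> 0\<close> by simp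
  qed (use t in simp)
  moreover have "filterlim (\<lambda>k. t / 2 ^ k) (at_right 0) sequentially"
    unfolding filterlim_at using t
    by (auto intro!: always_eventually tendsto_eq_intros LIMSEQ_divide_realpow_zero)
  ultimately have "(\<lambda>k::nat. 0) \<longlonglongrightarrow> f"
    using filterlim_compose[OF C0_semigroup_tendsto[OF T, of f]] by fastforce
  then show False using \<open>f \<noteq> 0\<close> LIMSEQ_unique[OF tendsto_const] by blast
qed

section \<open>Functionals along orbits and invariant ideals\<close>

text \<open>The common form of (ii), (iv) and (v), which differ only in the set \<open>M\<close> of
  admissible times.\<close>

definition hits ::
  "('k::real_normed_field \<Rightarrow> 'e::{real_normed_vector,ord} \<Rightarrow> 'e) \<Rightarrow> (real \<Rightarrow> 'e \<Rightarrow> 'e) \<Rightarrow> real set \<Rightarrow> bool" where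
  "hits sc T M \<longleftrightarrow> (\<forall>f \<phi>. 0 \<le> f \<and> f \<noteq> 0 \<and> pos_functional sc \<phi> \<and> \<phi> \<noteq> (\<lambda>_. 0) \<longrightarrow> (\<exists>t\<in>M. \<phi> (T t f) \<noteq> 0))"

text \<open>The ideal generated by the positive part of the orbit of \<open>f\<close> is the one generated by the
  single vector \<open>h\<close>, a weighted sum of the orbit over a dense set of times.\<close>

lemma orbit_closed_ideal:
  fixes T :: "real \<Rightarrow> 'a::banach_lattice \<Rightarrow> 'a"
  assumes T: "C0_semigroup scaleR T" and pos: "indiv_eventually_positive T"
    and \<phi>: "pos_functional scaleR \<phi>"
    and t0: "0 \<le> t\<^sub>0" "\<And>t. t\<^sub>0 \<le> t \<Longrightarrow> 0 \<le> T t f" "\<And>t. t\<^sub>0 \<le> t \<Longrightarrow> \<phi> (T t f) = 0"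
  shows "\<exists>I. closed_ideal scaleR I \<and> (\<forall>x\<in>I. \<phi> x = 0) \<and> (\<forall>t\<ge>t\<^sub>0. T t f \<in> I) \<and>
    (\<exists>t\<^sub>1\<ge>0. \<forall>t\<ge>t\<^sub>1. T t ` I \<subseteq> I)"
proof -
  interpret \<phi>: bounded_linear \<phi> by (rule pos_functional_bounded_linear[OF \<phi>])
  \<comment> \<open>An enumeration of the rationals, folded by the absolute value and shifted, gives
    times that are dense in \<open>[t\<^sub>0, \<infinity>)\<close> and never leave it.\<close>
  define q where "q n = t\<^sub>0 + \<bar>of_rat (nat_to_rat_surj n)\<bar>" for n
  \<comment> \<open>Weights that bound the n-th term of the series by 2^(-n) in norm; the summand 1
    avoids division by zero.\<close>
  define w where "w n = (1 / 2) ^ n / (1 + norm (T (q n) f))" for n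
  have q: "t\<^sub>0 \<le> q n" "0 \<le> q n" for n using t0(1) by (auto simp: q_def)
  have w: "0 < w n" for n by (simp add: w_def add_pos_nonneg)
  have "summable (\<lambda>n. w n *\<^sub>R T (q n) f)"
  proof (rule summable_comparison_test)
    have "norm (w n *\<^sub>R T (q n) f) \<le> (1 / 2) ^ n" for n
      using w[of n] by (simp add: w_def divide_simps add_pos_nonneg)
    then show "\<exists>N. \<forall>n\<ge>N. norm (w n *\<^sub>R T (q n) f) \<le> (1 / 2) ^ n" by blast
    show "summable (\<lambda>n. (1 / 2) ^ n :: real)" by (rule summable_geometric) simp
  qed
  then obtain h where h: "(\<lambda>n. w n *\<^sub>R T (q n) f) sums h" by (auto simp: summable_def)
  have terms: "0 \<le> w n *\<^sub>R T (q n) f" for n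
    using w[of n] q t0(2) by (intro scaleR_nonneg_nonneg) auto
  have partial: "(\<Sum>k<n. w k *\<^sub>R T (q k) f) \<le> h" for n
  proof (rule le_limit[OF tendsto_const])
    show "(\<lambda>m. \<Sum>k<m + n. w k *\<^sub>R T (q k) f) \<longlonglongrightarrow> h"
      using h unfolding sums_def by (rule LIMSEQ_ignore_initial_segment)
    show "(\<Sum>k<n. w k *\<^sub>R T (q k) f) \<le> (\<Sum>k<m + n. w k *\<^sub>R T (q k) f)" for m
      by (rule sum_mono2) (use terms in auto)
  qed
  have h0: "0 \<le> h" using partial[of 0] by simp
  let ?I = "principal_closed_ideal h"
  have I: "closed_ideal scaleR ?I" by (rule closed_ideal_principal[OF h0])
  \<comment> \<open>Every single term is at most \<open>h\<close> because the others are positive;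
    dividing by the weight puts the orbit vector below a multiple of \<open>h\<close>.\<close>
  have qI: "T (q n) f \<in> ?I" for n
  proof (rule principal_closed_idealI_le)
    have "w n *\<^sub>R T (q n) f \<le> (\<Sum>k<Suc n. w k *\<^sub>R T (q k) f)"
      using sum_nonneg[of "{..<n}" "\<lambda>k. w k *\<^sub>R T (q k) f"] terms by simp
    also have "\<dots> \<le> h" by (rule partial)
    finally have "inverse (w n) *\<^sub>R (w n *\<^sub>R T (q n) f) \<le> inverse (w n) *\<^sub>R h"
      using w[of n] by (intro scaleR_left_mono) auto
    then show "\<bar>T (q n) f\<bar> \<le> inverse (w n) *\<^sub>R h"
      using w[of n] t0(2)[OF q(1)[of n]] by (simp add: abs_of_nonneg)
    show "0 \<le> inverse (w n)" using w[of n] by simp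
  qed
  have orbit: "T t f \<in> ?I" if t: "t\<^sub>0 \<le> t" for t
  proof (rule orbit_mem_closed[OF T closed_ideal_closed[OF I]])
    show "0 \<le> t" using t t0(1) by simp
    fix e :: real assume "0 < e"
    \<comment> \<open>This rational exceeds \<open>t - t\<^sub>0 \<ge> 0\<close>, so it equals its
      absolute value and \<open>t\<^sub>0 + r\<close> is one of the times
      \<open>q n\<close>.\<close>
    then obtain r where r: "t - t\<^sub>0 < of_rat r" "of_rat r < t - t\<^sub>0 + e"
      using of_rat_dense[of "t - t\<^sub>0" "t - t\<^sub>0 + e"] by auto
    obtain n where n: "r = nat_to_rat_surj n" using surj_nat_to_rat_surj by (metis surjD)
    have "0 < real_of_rat r" using r(1) t by linarith
    then have "0 < r" by (simp only: zero_less_of_rat_iff)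
    then have "q n = t\<^sub>0 + of_rat r" by (simp add: q_def flip: n)
    then show "\<exists>s. 0 < s \<and> s < e \<and> T (t + s) f \<in> ?I"
      using qI[of n] r by (intro exI[of _ "q n - t"]) auto
  qed
  \<comment> \<open>\<open>T t\<close> acts termwise on the series and sends
    \<open>T (q n) f\<close> to the orbit vector at time \<open>t + q n\<close>, which is still at
    least \<open>t\<^sub>0\<close>.\<close>
  have into: "T t h \<in> ?I" if t: "0 \<le> t" for t
  proof -
    interpret Tt: bounded_linear "T t" by (rule C0_semigroup_bounded_linear[OF T t])
    have lim: "(\<lambda>n. \<Sum>k<n. T t (w k *\<^sub>R T (q k) f)) \<longlonglongrightarrow> T t h"
      using Tt.sums[OF h] by (simp only: sums_def)
    have "T t (w n *\<^sub>R T (q n) f) \<in> ?I" for n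
      using orbit[of "t + q n"] q[of n] t C0_semigroup_add[OF T t q(2)[of n], of f]
      by (auto simp: Tt.scale intro!: subspace_scale closed_ideal_subspace[OF I])
    then have "(\<Sum>k<n. T t (w k *\<^sub>R T (q k) f)) \<in> ?I" for n
      by (intro subspace_sum closed_ideal_subspace[OF I])
    then show ?thesis using lim by (rule closed_sequentially[OF closed_ideal_closed[OF I]])
  qed
  have "\<phi> h = 0"
  proof -
    have "(\<lambda>n. \<phi> (w n *\<^sub>R T (q n) f)) sums \<phi> h" by (rule \<phi>.sums[OF h])
    then have "(\<lambda>n. 0) sums \<phi> h" using t0(3)[OF q(1)] by (simp add: \<phi>.scale)
    then show ?thesis using sums_unique2 sums_zero by blast
  qed
  \<comment> \<open>A positive functional vanishing at \<open>h\<close> vanishes on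
    \<open>[0, h]\<close>, hence on the closed ideal generated by it.\<close>
  have "?I \<subseteq> {x. \<phi> x = 0}"
  proof (rule principal_closed_ideal_subset[OF h0])
    show "subspace {x. \<phi> x = 0}" by (auto simp: subspace_def \<phi>.add \<phi>.scale)
    have "{x. \<phi> x = 0} = \<phi> -` {0}" by auto
    then show "closed {x. \<phi> x = 0}"
      by (auto intro!: continuous_closed_vimage linear_continuous_at \<phi>.bounded_linear_axioms)
    show "y \<in> {x. \<phi> x = 0}" if "0 \<le> y" "y \<le> h" for y
      using pos_functional_nonneg[OF \<phi>, of y] pos_functional_nonneg[OF \<phi>, of "h - y"] that \<open>\<phi> h = 0\<close>
      by (simp add: \<phi>.diff)
  qed
  moreover have "\<exists>t\<^sub>1\<ge>0. \<forall>t\<ge>t\<^sub>1. T t ` ?I \<subseteq> ?I"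
    by (rule eventually_into_ideal_uniform[OF T pos I h0, of 0]) (rule into)
  ultimately show ?thesis using I orbit by blast
qed

lemma persistently_irreducible_imp_hits:
  fixes T :: "real \<Rightarrow> 'a::banach_lattice \<Rightarrow> 'a"
  assumes T: "C0_semigroup scaleR T" and pos: "indiv_eventually_positive T"
    and irr: "persistently_irreducible scaleR T" and "0 \<le> t\<^sub>0"
  shows "hits scaleR T {t\<^sub>0..}"
proof (rule ccontr)
  have triv: "I = {0} \<or> I = UNIV"
    if "closed_ideal scaleR I" "0 \<le> t" "\<And>s. t \<le> s \<Longrightarrow> T s ` I \<subseteq> I" for I t
    using irr that unfolding persistently_irreducible_def by blast
  assume "\<not> hits scaleR T {t\<^sub>0..}"
  then obtain f \<phi> where f: "0 \<le> f" "f \<noteq> 0" and \<phi>: "pos_functional scaleR \<phi>" "\<phi> \<noteq> (\<lambda>_. 0)"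
    and zero: "\<And>t. t\<^sub>0 \<le> t \<Longrightarrow> \<phi> (T t f) = 0"
    unfolding hits_def by auto
  obtain t where t: "0 \<le> t" "\<And>s. t \<le> s \<Longrightarrow> 0 \<le> T s f"
    using pos f(1) unfolding indiv_eventually_positive_def by blast
  \<comment> \<open>The maximum with 1 makes the time strictly positive, as the halving argument at
    the end requires.\<close>
  define t\<^sub>1 where "t\<^sub>1 = max 1 (max t t\<^sub>0)"
  have t1: "0 \<le> t\<^sub>1" "1 \<le> t\<^sub>1" "\<And>s. t\<^sub>1 \<le> s \<Longrightarrow> 0 \<le> T s f" "\<And>s. t\<^sub>1 \<le> s \<Longrightarrow> \<phi> (T s f) = 0"
    using t zero by (auto simp: t\<^sub>1_def)
  from orbit_closed_ideal[OF T pos \<phi>(1) t1(1,3,4)] obtain I t\<^sub>2 where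
    I: "closed_ideal scaleR I" "\<forall>x\<in>I. \<phi> x = 0" "\<forall>t\<ge>t\<^sub>1. T t f \<in> I" "0 \<le> t\<^sub>2" "\<forall>t\<ge>t\<^sub>2. T t ` I \<subseteq> I"
    by blast
  \<comment> \<open>The nonzero \<open>\<phi>\<close> annihilates \<open>I\<close>, so persistent
    irreducibility leaves only \<open>{0}\<close>, and the orbit of \<open>f\<close> dies from
    \<open>t\<^sub>1\<close> on.\<close>
  have "I \<noteq> UNIV" using I(2) \<phi>(2) by auto
  then have "I = {0}" using triv[OF I(1,4)] I(5) by blast
  then have zero: "T s f = 0" if "t\<^sub>1 \<le> s" for s using I(3) that by blast
  let ?P = "principal_closed_ideal f"
  have P: "closed_ideal scaleR ?P" by (rule closed_ideal_principal[OF f(1)])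
  \<comment> \<open>The same lemma with target \<open>{0}\<close>: from \<open>t\<^sub>3\<close> on
    the ideal generated by \<open>f\<close> is sent to zero. It is thus eventually invariant and
    contains \<open>f \<noteq> 0\<close>, so it is the whole space.\<close>
  from eventually_into_ideal_uniform[OF T pos closed_ideal_trivial f(1), of t\<^sub>1]
  obtain t\<^sub>3 where t3: "0 \<le> t\<^sub>3" "\<forall>t\<ge>t\<^sub>3. T t ` ?P \<subseteq> {0}" using zero by blast
  have "?P = {0} \<or> ?P = UNIV"
  proof (rule triv[OF P t3(1)])
    fix s assume "t\<^sub>3 \<le> s"
    then have "T s ` ?P \<subseteq> {0}" using t3(2) by blast
    also have "{0} \<subseteq> ?P" using closed_ideal_zero[OF P] by simp
    finally show "T s ` ?P \<subseteq> ?P" .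
  qed
  moreover have "f \<in> ?P"
    using f(1) by (intro principal_closed_idealI_le[of _ 1]) (auto simp: abs_of_nonneg)
  ultimately have "?P = UNIV" using f(2) by blast
  then have nil: "T s x = 0" if "t\<^sub>3 \<le> s" for s x using t3(2) that by blast
  have "f = 0"
  proof (rule nilpotent_imp_zero[OF T _ f(1)])
    show "0 < t\<^sub>1" "T t\<^sub>1 f = 0" using t1(2) zero by auto
    show "I = {0} \<or> I = UNIV" if "closed_ideal scaleR I" for I :: "'a set"
      using nil closed_ideal_zero[OF that] by (intro triv[OF that t3(1)]) auto
  qed
  then show False using f(2) by simp
qed

text \<open>A nonzero \<open>x\<close> in a proper \<open>I\<close> would give a positive vector
  \<open>\<bar>x\<bar>\<close> in \<open>I\<close> whose orbit at the times in \<open>M\<close>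
  stays in the kernel of a separating functional. This yields both (ii) to (i) and (iv) to
  (iii).\<close>

lemma hits_ideal_trivial:
  fixes T :: "real \<Rightarrow> 'a::banach_lattice \<Rightarrow> 'a"
  assumes I: "closed_ideal scaleR I" and hits: "hits scaleR T M" and inv: "\<And>t. t \<in> M \<Longrightarrow> T t ` I \<subseteq> I"
  shows "I = {0} \<or> I = UNIV"
proof (rule ccontr)
  assume "\<not> ?thesis"
  then have "I \<noteq> {0}" "I \<noteq> UNIV" by auto
  obtain x where "x \<in> I" "x \<noteq> 0" using \<open>I \<noteq> {0}\<close> closed_ideal_zero[OF I] by blast
  then have f: "\<bar>x\<bar> \<in> I" "0 \<le> \<bar>x\<bar>" "\<bar>x\<bar> \<noteq> 0" using closed_ideal_abs_iff[OF I] by auto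
  obtain \<phi> where \<phi>: "pos_functional scaleR \<phi>" "\<phi> \<noteq> (\<lambda>_. 0)" "\<forall>x\<in>I. \<phi> x = 0"
    using closed_ideal_separation[OF I \<open>I \<noteq> UNIV\<close>] by blast
  obtain t where "t \<in> M" "\<phi> (T t \<bar>x\<bar>) \<noteq> 0" using hits f \<phi> unfolding hits_def by blast
  then show False using \<phi>(3) f(1) inv by blast
qed

text \<open>The equivalences close the cycle (iii), (v), (iv), (iii).\<close>

lemma real_irreducibility_implications:
  fixes T :: "real \<Rightarrow> 'a::banach_lattice \<Rightarrow> 'a"
  assumes T: "C0_semigroup scaleR T" and pos: "indiv_eventually_positive T"
  shows "persistently_irreducible scaleR T \<longleftrightarrow> (\<forall>t\<^sub>0\<ge>0. hits scaleR T ({0} \<union> {t\<^sub>0..}))"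
    and "(\<forall>t\<^sub>0\<ge>0. hits scaleR T ({0} \<union> {t\<^sub>0..})) \<longleftrightarrow> (\<forall>t\<^sub>0\<ge>0. hits scaleR T {t\<^sub>0..})"
    and "hits scaleR T {0..} \<longrightarrow> irreducible_semigroup scaleR T"
proof -
  have mono: "hits scaleR T M \<Longrightarrow> M \<subseteq> N \<Longrightarrow> hits scaleR T N" for M N
    unfolding hits_def by blast
  have iv_iii: "persistently_irreducible scaleR T" if iv: "\<forall>t\<^sub>0\<ge>0. hits scaleR T ({0} \<union> {t\<^sub>0..})"
  proof -
    have "I = {0} \<or> I = UNIV"
      if I: "closed_ideal scaleR I" "0 \<le> t" "\<forall>s\<ge>t. T s ` I \<subseteq> I" for I t
    proof (rule hits_ideal_trivial[OF I(1)])
      show "hits scaleR T ({0} \<union> {t..})" using iv I(2) by blast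
      \<comment> \<open>The extra time 0 in (iv) preserves every ideal because \<open>T 0\<close> is
        the identity.\<close>
      show "T s ` I \<subseteq> I" if "s \<in> {0} \<union> {t..}" for s
        using that I(3) C0_semigroup_zero[OF T] by auto
    qed
    then show ?thesis unfolding persistently_irreducible_def by blast
  qed
  moreover have v_iv: "\<forall>t\<^sub>0\<ge>0. hits scaleR T ({0} \<union> {t\<^sub>0..})" if "\<forall>t\<^sub>0\<ge>0. hits scaleR T {t\<^sub>0..}"
    using that mono[of "{t\<^sub>0..}" "{0} \<union> {t\<^sub>0..}" for t\<^sub>0] by blast
  moreover have iii_v: "\<forall>t\<^sub>0\<ge>0. hits scaleR T {t\<^sub>0..}" if "persistently_irreducible scaleR T"
    using persistently_irreducible_imp_hits[OF T pos that] by blast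
  ultimately show "persistently_irreducible scaleR T \<longleftrightarrow> (\<forall>t\<^sub>0\<ge>0. hits scaleR T ({0} \<union> {t\<^sub>0..}))"
    and "(\<forall>t\<^sub>0\<ge>0. hits scaleR T ({0} \<union> {t\<^sub>0..})) \<longleftrightarrow> (\<forall>t\<^sub>0\<ge>0. hits scaleR T {t\<^sub>0..})"
    by blast+
  show "hits scaleR T {0..} \<longrightarrow> irreducible_semigroup scaleR T"
    unfolding irreducible_semigroup_def using hits_ideal_trivial[of _ T "{0..}"] by auto
qed

section \<open>Reduction of the complex case to the real part\<close>

lemma nonneg_complexification_iff: "0 \<le> z \<longleftrightarrow> (\<exists>x\<ge>0. z = Complexify x 0)"
  for z :: "'a::banach_lattice complexification"
  by (cases z) (auto simp: less_eq_complexification_def)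

lemma complexification_decomp: "z = Complexify (real_part z) 0 + scaleC \<i> (Complexify (imag_part z) 0)"
  by (rule cx_eqI) (simp_all add: scaleC_def)

lemma Complexify_simps:
  "Complexify (x + y) 0 = Complexify x 0 + Complexify y 0"
  "Complexify (c *\<^sub>R x) 0 = scaleC (of_real c) (Complexify x 0)"
  by (auto intro: cx_eqI simp: scaleC_def)

lemma bounded_linear_real_part: "bounded_linear (real_part :: 'a::banach_lattice complexification \<Rightarrow> 'a)"
  by (rule bounded_linear_intro[where K = 1]) (auto simp: norm_parts_le)

lemma bounded_linear_imag_part: "bounded_linear (imag_part :: 'a::banach_lattice complexification \<Rightarrow> 'a)"
  by (rule bounded_linear_intro[where K = 1]) (auto simp: norm_parts_le)

lemma bounded_linear_Complexify: "bounded_linear (\<lambda>x :: 'a::banach_lattice. Complexify x 0)"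
  by (rule bounded_linear_intro[where K = 1]) (auto simp: norm_Complexify_0 intro: cx_eqI)

lemma scaleC_linearD:
  assumes "Vector_Spaces.linear scaleC sc F"
  shows "F (x + y) = F x + F y" "F (scaleC c x) = sc c (F x)" "F 0 = 0"
proof -
  interpret Vector_Spaces.linear scaleC sc F by fact
  show "F (x + y) = F x + F y" "F (scaleC c x) = sc c (F x)" "F 0 = 0"
    by (simp_all add: add scale)
qed

lemma subspace_scaleC_iff:
  "module.subspace scaleC I \<longleftrightarrow> 0 \<in> I \<and> (\<forall>x\<in>I. \<forall>y\<in>I. x + y \<in> I) \<and> (\<forall>c. \<forall>x\<in>I. scaleC c x \<in> I)"
proof -
  interpret vector_space scaleC by (rule vector_space_scaleC)
  show ?thesis by (auto simp: subspace_def)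
qed

section \<open>Closed ideals of the complexification\<close>

definition cx_set :: "'a::banach_lattice set \<Rightarrow> 'a complexification set" where
  "cx_set J = {z. real_part z \<in> J \<and> imag_part z \<in> J}"

lemma Complexify_mem_cx_set: "0 \<in> J \<Longrightarrow> Complexify x 0 \<in> cx_set J \<longleftrightarrow> x \<in> J"
  by (simp add: cx_set_def)

text \<open>Solidity follows from the chain |Re z|, |Im z| \<le> |z| \<le> |w| \<le> |Re w| + |Im
  w|, whose last member lies in \<open>J\<close>.\<close>

lemma closed_ideal_cx_set:
  fixes J :: "'a::banach_lattice set"
  assumes J: "closed_ideal scaleR J"
  shows "closed_ideal scaleC (cx_set J)"
  unfolding closed_ideal_def
proof (intro conjI allI impI)
  note sub = closed_ideal_subspace[OF J]
  show "module.subspace scaleC (cx_set J)"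
    by (auto simp: subspace_scaleC_iff cx_set_def scaleC_def
        intro!: subspace_0 subspace_add subspace_diff subspace_scale sub)
  have "cx_set J = real_part -` J \<inter> imag_part -` J" by (auto simp: cx_set_def)
  then show "closed (cx_set J)"
    by (auto intro!: closed_Int continuous_closed_vimage closed_ideal_closed[OF J] linear_continuous_at
        bounded_linear_real_part bounded_linear_imag_part)
  fix z w :: "'a complexification" assume zw: "w \<in> cx_set J \<and> \<bar>z\<bar> \<le> \<bar>w\<bar>"
  let ?m = "modulus (real_part z) (imag_part z)"
  have "?m \<le> modulus (real_part w) (imag_part w)"
    using zw by (simp add: abs_complexification_def less_eq_complexification_def)
  then have le: "?m \<le> \<bar>real_part w\<bar> + \<bar>imag_part w\<bar>" by (rule order_trans[OF _ modulus_le])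
  have "\<bar>real_part w\<bar> + \<bar>imag_part w\<bar> \<in> J"
    using zw by (intro subspace_add[OF sub]) (auto simp: cx_set_def closed_ideal_abs_iff[OF J])
  then have "?m \<in> J" by (rule closed_ideal_between[OF J _ modulus_nonneg le])
  then have "\<bar>real_part z\<bar> \<in> J" "\<bar>imag_part z\<bar> \<in> J"
    using abs_le_modulus(1)[of "real_part z" "imag_part z"] abs_le_modulus(2)[of "imag_part z" "real_part z"]
    by (auto intro: closed_ideal_between[OF J _ abs_ge_zero])
  then show "z \<in> cx_set J" by (simp add: cx_set_def closed_ideal_abs_iff[OF J])
qed

text \<open>\<open>J\<close> consists of the real vectors of \<open>I\<close>. Both parts of
  \<open>z\<close> are dominated by the modulus of \<open>z\<close> and so belong to
  \<open>I\<close> with it; conversely \<open>z\<close> is a complex combination of its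
  parts.\<close>

lemma closed_ideal_complexification_cases:
  fixes I :: "'a::banach_lattice complexification set"
  assumes I: "closed_ideal scaleC I"
  shows "\<exists>J. closed_ideal scaleR J \<and> I = cx_set J"
proof -
  have sub: "0 \<in> I" "\<And>z w. z \<in> I \<Longrightarrow> w \<in> I \<Longrightarrow> z + w \<in> I" "\<And>c z. z \<in> I \<Longrightarrow> scaleC c z \<in> I"
    and solid: "\<And>z w. w \<in> I \<Longrightarrow> \<bar>z\<bar> \<le> \<bar>w\<bar> \<Longrightarrow> z \<in> I" and cl: "closed I"
    using I by (auto simp: closed_ideal_def subspace_scaleC_iff)
  define J where "J = (\<lambda>x. Complexify x 0) -` I"
  have "closed_ideal scaleR J"
  proof (rule closed_idealI)
    have "Complexify (0::'a) 0 \<in> I" using sub(1) by (simp add: zero_complexification_def)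
    then show "subspace J" by (auto simp: subspace_def J_def Complexify_simps sub)
    show "closed J"
      unfolding J_def using bounded_linear_Complexify
      by (intro continuous_closed_vimage[OF cl]) (rule linear_continuous_at)
    show "x \<in> J" if "y \<in> J" "\<bar>x\<bar> \<le> \<bar>y\<bar>" for x y
      using solid[of "Complexify y 0" "Complexify x 0"] that
      by (simp add: J_def abs_complexification_def less_eq_complexification_def)
  qed
  moreover have "I = cx_set J"
  proof (intro set_eqI iffI)
    fix z assume z: "z \<in> I"
    have "Complexify (real_part z) 0 \<in> I" "Complexify (imag_part z) 0 \<in> I"
      using abs_le_modulus(1)[of "real_part z" "imag_part z"]
        abs_le_modulus(2)[of "imag_part z" "real_part z"]
      by (auto intro!: solid[OF z] simp: abs_complexification_def less_eq_complexification_def)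
    then show "z \<in> cx_set J" by (simp add: cx_set_def J_def)
  next
    fix z assume "z \<in> cx_set J"
    then show "z \<in> I"
      by (subst complexification_decomp) (auto simp: cx_set_def J_def intro!: sub)
  qed
  ultimately show ?thesis by blast
qed

lemma cx_set_trivial_iff:
  assumes "0 \<in> J"
  shows "cx_set J = {0} \<longleftrightarrow> J = {0}" "cx_set J = UNIV \<longleftrightarrow> J = UNIV"
proof -
  note mem = Complexify_mem_cx_set[OF assms]
  show "cx_set J = {0} \<longleftrightarrow> J = {0}"
  proof
    assume "cx_set J = {0}"
    then have "x = 0" if "x \<in> J" for x
      using that mem[of x] by (simp add: zero_complexification_def)
    then show "J = {0}" using assms by blast
  qed (auto simp: cx_set_def intro: cx_eqI)
  show "cx_set J = UNIV \<longleftrightarrow> J = UNIV"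
  proof
    assume "cx_set J = UNIV"
    then show "J = UNIV" using mem by blast
  qed (auto simp: cx_set_def)
qed

section \<open>Positive functionals on the complexification\<close>

text \<open>For linear \<open>\<psi>\<close>, its unique complex-linear extension.\<close>

definition cx_functional :: "('a::banach_lattice \<Rightarrow> real) \<Rightarrow> 'a complexification \<Rightarrow> complex" where
  "cx_functional \<psi> z = Complex (\<psi> (real_part z)) (\<psi> (imag_part z))"

lemma pos_functional_cx_functional:
  fixes \<psi> :: "'a::banach_lattice \<Rightarrow> real"
  assumes \<psi>: "pos_functional scaleR \<psi>"
  shows "pos_functional scaleC (cx_functional \<psi>)"
proof -
  interpret \<psi>: bounded_linear \<psi> by (rule pos_functional_bounded_linear[OF \<psi>])
  interpret C: vector_space scaleC by (rule vector_space_scaleC)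
  interpret M: vector_space "(*) :: complex \<Rightarrow> complex \<Rightarrow> complex"
    by unfold_locales (auto simp: algebra_simps)
  have lin: "Vector_Spaces.linear scaleC (*) (cx_functional \<psi>)"
    by unfold_locales
      (auto simp: cx_functional_def scaleC_def \<psi>.add \<psi>.diff \<psi>.scale complex_eq_iff)
  obtain K where K: "0 \<le> K" "\<And>x. norm (\<psi> x) \<le> norm x * K" using \<psi>.nonneg_bounded by blast
  have "norm (cx_functional \<psi> z) \<le> (2 * K) * norm z" for z
  proof -
    have "norm (cx_functional \<psi> z) \<le> norm (\<psi> (real_part z)) + norm (\<psi> (imag_part z))"
      using cmod_le[of "cx_functional \<psi> z"] by (simp add: cx_functional_def)
    also have "\<dots> \<le> norm (real_part z) * K + norm (imag_part z) * K"
      by (intro add_mono K)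
    also have "\<dots> \<le> norm z * K + norm z * K"
      using K(1) by (intro add_mono mult_right_mono norm_parts_le)
    finally show ?thesis by (simp add: algebra_simps)
  qed
  moreover have "cx_functional \<psi> f \<in> \<real>\<^sub>\<ge>\<^sub>0" if "0 \<le> f" for f
    using that pos_functional_nonneg[OF \<psi>]
    by (auto simp: nonneg_complexification_iff cx_functional_def \<psi>.zero complex_nonneg_Reals_iff)
  ultimately show ?thesis
    using lin by (auto simp: pos_functional_def dual_def bounded_operator_def)
qed

text \<open>\<open>\<phi>\<close> takes real values on the positive cone, hence on all real vectors,
  since these are differences of positive ones; complex linearity then recovers it from its
  restriction \<open>\<psi>\<close>.\<close>

lemma pos_functional_complexification_cases:
  fixes \<phi> :: "'a::banach_lattice complexification \<Rightarrow> complex"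
  assumes \<phi>: "pos_functional scaleC \<phi>"
  shows "\<exists>\<psi>. pos_functional scaleR \<psi> \<and> \<phi> = cx_functional \<psi>"
proof -
  have lin: "Vector_Spaces.linear scaleC (*) \<phi>" and pos: "\<And>f. 0 \<le> f \<Longrightarrow> \<phi> f \<in> \<real>\<^sub>\<ge>\<^sub>0"
    using \<phi> by (auto simp: pos_functional_def dual_def bounded_operator_def)
  obtain K where K: "\<And>z. norm (\<phi> z) \<le> K * norm z"
    using \<phi> by (auto simp: pos_functional_def dual_def bounded_operator_def)
  note \<phi>_simps = scaleC_linearD[OF lin]
  define \<psi> where "\<psi> x = Re (\<phi> (Complexify x 0))" for x
  have real: "\<phi> (Complexify x 0) = of_real (\<psi> x)" for x
  proof -
    have cone: "Im (\<phi> (Complexify y 0)) = 0" if "0 \<le> y" for y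
      using pos[of "Complexify y 0"] that
      by (auto simp: less_eq_complexification_def complex_nonneg_Reals_iff)
    have "Complexify (pprt x) 0 = Complexify x 0 + Complexify (pprt (- x)) 0"
    proof -
      have "pprt x = x + pprt (- x)" by (metis add_diff_cancel_right' diff_add_cancel diff_minus_eq_add prts pprt_neg)
      then show ?thesis by (simp flip: Complexify_simps(1))
    qed
    then have "Im (\<phi> (Complexify (pprt x) 0)) = Im (\<phi> (Complexify x 0)) + Im (\<phi> (Complexify (pprt (- x)) 0))"
      by (simp add: \<phi>_simps)
    then have "Im (\<phi> (Complexify x 0)) = 0" using cone[of "pprt x"] cone[of "pprt (- x)"] by simp
    then show ?thesis by (simp add: \<psi>_def complex_eq_iff)
  qed
  have "pos_functional scaleR \<psi>"
  proof (rule pos_functionalI)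
    show "bounded_linear \<psi>"
    proof (rule bounded_linear_intro[where K = K])
      show "norm (\<psi> x) \<le> norm x * K" for x
        using K[of "Complexify x 0"] by (simp add: real norm_Complexify_0 mult.commute)
    qed (simp_all only: \<psi>_def Complexify_simps \<phi>_simps, simp_all)
    show "0 \<le> \<psi> f" if "0 \<le> f" for f
      using pos[of "Complexify f 0"] that
      by (auto simp: less_eq_complexification_def \<psi>_def complex_nonneg_Reals_iff)
  qed
  moreover have "\<phi> = cx_functional \<psi>"
  proof
    fix z
    have "\<phi> z = \<phi> (Complexify (real_part z) 0) + \<i> * \<phi> (Complexify (imag_part z) 0)"
      by (subst complexification_decomp) (simp only: \<phi>_simps)
    then show "\<phi> z = cx_functional \<psi> z" by (simp add: real cx_functional_def complex_eq_iff)
  qed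
  ultimately show ?thesis by blast
qed

section \<open>Restriction of a real semigroup to the real part\<close>

text \<open>For a real semigroup and \<open>t \<ge> 0\<close> taking the real part loses nothing, as
  the imaginary part is 0.\<close>

definition real_restriction ::
  "(real \<Rightarrow> 'a::banach_lattice complexification \<Rightarrow> 'a complexification) \<Rightarrow> real \<Rightarrow> 'a \<Rightarrow> 'a" where
  "real_restriction S t x = real_part (S t (Complexify x 0))"

lemma real_restriction_Complexify:
  assumes "real_semigroup S" "0 \<le> t"
  shows "S t (Complexify x 0) = Complexify (real_restriction S t x) 0"
proof (rule cx_eqI)
  have "S t (Complexify x 0) \<in> S t ` {f. imag_part f = 0}" by (rule imageI) simp
  then have "imag_part (S t (Complexify x 0)) = 0"
    using assms unfolding real_semigroup_def real_operator_def by blast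
  then show "imag_part (S t (Complexify x 0)) = imag_part (Complexify (real_restriction S t x) 0)"
    by simp
qed (simp add: real_restriction_def)

lemma real_restriction_parts:
  assumes S: "C0_semigroup scaleC S" and R: "real_semigroup S" and t: "0 \<le> t"
  shows "S t z = Complexify (real_restriction S t (real_part z)) (real_restriction S t (imag_part z))"
proof -
  have lin: "Vector_Spaces.linear scaleC scaleC (S t)"
    using S t by (auto simp: C0_semigroup_def bounded_operator_def)
  have "S t z = S t (Complexify (real_part z) 0) + scaleC \<i> (S t (Complexify (imag_part z) 0))"
    by (subst complexification_decomp) (simp only: scaleC_linearD[OF lin])
  then show ?thesis
    by (auto simp: real_restriction_Complexify[OF R t] scaleC_def intro: cx_eqI)
qed

lemma C0_semigroup_real_restriction:
  assumes S: "C0_semigroup scaleC S" and R: "real_semigroup S"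
  shows "C0_semigroup scaleR (real_restriction S)"
  unfolding C0_semigroup_def bounded_operator_scaleR
proof (intro conjI allI impI)
  fix t :: real assume t: "0 \<le> t"
  have lin: "Vector_Spaces.linear scaleC scaleC (S t)" and "\<exists>K. \<forall>z. norm (S t z) \<le> K * norm z"
    using S t by (auto simp: C0_semigroup_def bounded_operator_def)
  then obtain K where K: "\<And>z. norm (S t z) \<le> K * norm z" by blast
  show "bounded_linear (real_restriction S t)"
  proof (rule bounded_linear_intro[where K = K])
    show "norm (real_restriction S t x) \<le> norm x * K" for x
      using K[of "Complexify x 0"]
      by (simp add: real_restriction_Complexify[OF R t] norm_Complexify_0 mult.commute)
    show "real_restriction S t (x + y) = real_restriction S t x + real_restriction S t y" for x y
      by (simp add: real_restriction_def Complexify_simps scaleC_linearD[OF lin])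
    have "S t (Complexify (c *\<^sub>R x) 0) = c *\<^sub>R S t (Complexify x 0)" for c x
      by (simp only: Complexify_simps scaleC_linearD[OF lin]) (rule scaleC_of_real)
    then show "real_restriction S t (c *\<^sub>R x) = c *\<^sub>R real_restriction S t x" for c x
      by (simp add: real_restriction_def)
  qed
  show "real_restriction S (s + t) x = real_restriction S s (real_restriction S t x)"
    if s: "0 \<le> s" for s x
  proof -
    have "S (s + t) (Complexify x 0) = S s (S t (Complexify x 0))"
      using S s t by (simp add: C0_semigroup_def)
    also have "\<dots> = S s (Complexify (real_restriction S t x) 0)"
      by (simp only: real_restriction_Complexify[OF R t])
    finally show ?thesis by (simp add: real_restriction_def)
  qed
next
  fix x
  show "real_restriction S 0 x = x" using S by (simp add: C0_semigroup_def real_restriction_def)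
  have "((\<lambda>t. S t (Complexify x 0)) \<longlongrightarrow> Complexify x 0) (at_right 0)"
    using S by (simp add: C0_semigroup_def)
  from bounded_linear.tendsto[OF bounded_linear_real_part this]
  show "((\<lambda>t. real_restriction S t x) \<longlongrightarrow> x) (at_right 0)"
    by (simp add: real_restriction_def)
qed

lemma indiv_eventually_positive_real_restriction:
  assumes "indiv_eventually_positive S"
  shows "indiv_eventually_positive (real_restriction S)"
  unfolding indiv_eventually_positive_def
proof (intro allI impI)
  fix x :: 'a assume "0 \<le> x"
  then have "0 \<le> Complexify x 0" by (simp add: less_eq_complexification_def)
  then obtain t where "0 \<le> t" "\<forall>s\<ge>t. 0 \<le> S s (Complexify x 0)"
    using assms unfolding indiv_eventually_positive_def by blast
  then show "\<exists>t\<ge>0. \<forall>s\<ge>t. 0 \<le> real_restriction S s x"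
    by (auto simp: real_restriction_def less_eq_complexification_def)
qed

lemma invariant_cx_set_iff:
  fixes S :: "real \<Rightarrow> 'a::banach_lattice complexification \<Rightarrow> 'a complexification"
  assumes S: "C0_semigroup scaleC S" and R: "real_semigroup S" and t: "0 \<le> t" and "0 \<in> J"
  shows "S t ` cx_set J \<subseteq> cx_set J \<longleftrightarrow> real_restriction S t ` J \<subseteq> J"
proof
  assume L: "S t ` cx_set J \<subseteq> cx_set J"
  show "real_restriction S t ` J \<subseteq> J"
  proof (rule image_subsetI)
    fix x assume "x \<in> J"
    then have "S t (Complexify x 0) \<in> cx_set J" using L Complexify_mem_cx_set[OF assms(4)] by blast
    then show "real_restriction S t x \<in> J" by (simp add: cx_set_def real_restriction_def)
  qed
next
  assume "real_restriction S t ` J \<subseteq> J"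
  then show "S t ` cx_set J \<subseteq> cx_set J"
    by (auto simp: cx_set_def real_restriction_parts[OF S R t])
qed

text \<open>Closed ideals correspond through \<open>cx_set\<close>, with triviality and invariance
  preserved. The free starting time serves both notions of irreducibility.\<close>

lemma ex_closed_ideal_complexification_iff:
  fixes S :: "real \<Rightarrow> 'a::banach_lattice complexification \<Rightarrow> 'a complexification"
  assumes S: "C0_semigroup scaleC S" and R: "real_semigroup S" and t0: "0 \<le> t\<^sub>0"
  shows "(\<exists>I. closed_ideal scaleC I \<and> I \<noteq> {0} \<and> I \<noteq> UNIV \<and> (\<forall>t\<ge>t\<^sub>0. S t ` I \<subseteq> I)) \<longleftrightarrow>
    (\<exists>J. closed_ideal scaleR J \<and> J \<noteq> {0} \<and> J \<noteq> UNIV \<and> (\<forall>t\<ge>t\<^sub>0. real_restriction S t ` J \<subseteq> J))"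
    (is "?L \<longleftrightarrow> ?R")
proof -
  have inv: "(\<forall>t\<ge>t\<^sub>0. S t ` cx_set J \<subseteq> cx_set J) \<longleftrightarrow> (\<forall>t\<ge>t\<^sub>0. real_restriction S t ` J \<subseteq> J)"
    if "closed_ideal scaleR J" for J
    using invariant_cx_set_iff[OF S R _ closed_ideal_zero[OF that]] t0 by (meson order_trans)
  show ?thesis
  proof
    assume ?L
    then obtain I where I: "closed_ideal scaleC I" "I \<noteq> {0}" "I \<noteq> UNIV" "\<forall>t\<ge>t\<^sub>0. S t ` I \<subseteq> I" by blast
    obtain J where J: "closed_ideal scaleR J" "I = cx_set J"
      using closed_ideal_complexification_cases[OF I(1)] by blast
    have "J \<noteq> {0}" "J \<noteq> UNIV" "\<forall>t\<ge>t\<^sub>0. real_restriction S t ` J \<subseteq> J"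
      using I(2-4) cx_set_trivial_iff[OF closed_ideal_zero[OF J(1)]] inv[OF J(1)] unfolding J(2) by simp_all
    then show ?R using J(1) by blast
  next
    assume ?R
    then obtain J where J: "closed_ideal scaleR J" "J \<noteq> {0}" "J \<noteq> UNIV"
      "\<forall>t\<ge>t\<^sub>0. real_restriction S t ` J \<subseteq> J" by blast
    then have "cx_set J \<noteq> {0}" "cx_set J \<noteq> UNIV" "\<forall>t\<ge>t\<^sub>0. S t ` cx_set J \<subseteq> cx_set J"
      using cx_set_trivial_iff[OF closed_ideal_zero[OF J(1)]] inv[OF J(1)] by simp_all
    then show ?L using closed_ideal_cx_set[OF J(1)] by blast
  qed
qed

lemma irreducible_real_restriction_iff:
  assumes "C0_semigroup scaleC S" "real_semigroup S"
  shows "irreducible_semigroup scaleC S \<longleftrightarrow> irreducible_semigroup scaleR (real_restriction S)"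
  unfolding irreducible_semigroup_def using ex_closed_ideal_complexification_iff[OF assms order_refl] by simp

text \<open>Pulling the starting time out of the existential gives the form to which the
  correspondence of ideals applies.\<close>

lemma persistently_irreducible_iff:
  "persistently_irreducible sc T \<longleftrightarrow>
    (\<forall>t\<^sub>0\<ge>0. \<not> (\<exists>I. closed_ideal sc I \<and> I \<noteq> {0} \<and> I \<noteq> UNIV \<and> (\<forall>t\<ge>t\<^sub>0. T t ` I \<subseteq> I)))"
  unfolding persistently_irreducible_def by blast

lemma persistently_irreducible_real_restriction_iff:
  assumes "C0_semigroup scaleC S" "real_semigroup S"
  shows "persistently_irreducible scaleC S \<longleftrightarrow> persistently_irreducible scaleR (real_restriction S)"
  unfolding persistently_irreducible_iff using ex_closed_ideal_complexification_iff[OF assms] by simp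

text \<open>Positive vectors and positive functionals on both sides correspond, and so do their
  pairings. Times are taken in \<open>{0..}\<close> because reality of the semigroup is known
  there.\<close>

lemma hits_real_restriction_iff:
  fixes S :: "real \<Rightarrow> 'a::banach_lattice complexification \<Rightarrow> 'a complexification"
  assumes S: "C0_semigroup scaleC S" and R: "real_semigroup S" and M: "M \<subseteq> {0..}"
  shows "hits scaleC S M \<longleftrightarrow> hits scaleR (real_restriction S) M"
proof -
  have zero: "\<psi> 0 = 0" if "pos_functional scaleR \<psi>" for \<psi> :: "'a \<Rightarrow> real"
    using linear_0[OF bounded_linear.linear[OF pos_functional_bounded_linear[OF that]]] .
  have eval: "cx_functional \<psi> (S t (Complexify x 0)) \<noteq> 0 \<longleftrightarrow> \<psi> (real_restriction S t x) \<noteq> 0"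
    if "pos_functional scaleR \<psi>" "t \<in> M" for \<psi> :: "'a \<Rightarrow> real" and t x
    using that M zero[OF that(1)]
    by (auto simp: cx_functional_def real_restriction_Complexify[OF R] complex_eq_iff)
  have nonzero: "cx_functional \<psi> \<noteq> (\<lambda>_. 0) \<longleftrightarrow> \<psi> \<noteq> (\<lambda>_. 0)" for \<psi> :: "'a \<Rightarrow> real"
  proof -
    have "\<psi> x = 0" if "cx_functional \<psi> = (\<lambda>_. 0)" for x
      using fun_cong[OF that, of "Complexify x 0"] by (simp add: cx_functional_def complex_eq_iff)
    then show ?thesis by (auto simp: cx_functional_def complex_eq_iff)
  qed
  have pos: "0 \<le> Complexify x 0 \<and> Complexify x 0 \<noteq> 0 \<longleftrightarrow> 0 \<le> x \<and> x \<noteq> 0" for x :: 'a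
    by (auto simp: less_eq_complexification_def zero_complexification_def)
  show ?thesis
  proof
    assume H: "hits scaleC S M"
    show "hits scaleR (real_restriction S) M"
      unfolding hits_def
    proof (intro allI impI, elim conjE)
      fix x :: 'a and \<psi> :: "'a \<Rightarrow> real"
      assume x: "0 \<le> x" "x \<noteq> 0" and \<psi>: "pos_functional scaleR \<psi>" "\<psi> \<noteq> (\<lambda>_. 0)"
      have "\<exists>t\<in>M. cx_functional \<psi> (S t (Complexify x 0)) \<noteq> 0"
        using H pos[of x] x pos_functional_cx_functional[OF \<psi>(1)] \<psi>(2) nonzero unfolding hits_def by blast
      then show "\<exists>t\<in>M. \<psi> (real_restriction S t x) \<noteq> 0" using eval[OF \<psi>(1)] by blast
    qed
  next
    assume H: "hits scaleR (real_restriction S) M"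
    show "hits scaleC S M"
      unfolding hits_def
    proof (intro allI impI, elim conjE)
      fix f :: "'a complexification" and \<phi> :: "'a complexification \<Rightarrow> complex"
      assume f: "0 \<le> f" "f \<noteq> 0" and \<phi>: "pos_functional scaleC \<phi>" "\<phi> \<noteq> (\<lambda>_. 0)"
      obtain \<psi> where \<psi>: "pos_functional scaleR \<psi>" "\<phi> = cx_functional \<psi>"
        using pos_functional_complexification_cases[OF \<phi>(1)] by blast
      obtain x where x: "f = Complexify x 0" using f(1) nonneg_complexification_iff by blast
      have "\<exists>t\<in>M. \<psi> (real_restriction S t x) \<noteq> 0"
        using H pos[of x] f \<phi>(2) \<psi> nonzero unfolding hits_def x by blast
      then show "\<exists>t\<in>M. \<phi> (S t f) \<noteq> 0" using eval[OF \<psi>(1)] unfolding \<psi>(2) x by blast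
    qed
  qed
qed

section \<open>Assembling the conditions in the real and complex cases\<close>

text \<open>A form common to both scalar fields. The remaining implications, (iii) to (i) and (iv)
  to (ii), are the case \<open>t\<^sub>0 = 0\<close>.\<close>

lemma irreducibility_equivalences:
  assumes "persistently_irreducible sc T \<longleftrightarrow> (\<forall>t\<^sub>0\<ge>0. hits sc T ({0} \<union> {t\<^sub>0..}))"
    and "(\<forall>t\<^sub>0\<ge>0. hits sc T ({0} \<union> {t\<^sub>0..})) \<longleftrightarrow> (\<forall>t\<^sub>0\<ge>0. hits sc T {t\<^sub>0..})"
    and "hits sc T {0..} \<longrightarrow> irreducible_semigroup sc T"
  shows "let i = irreducible_semigroup sc T;
            ii = (\<forall>f \<phi>. 0 \<le> f \<and> f \<noteq> 0 \<and> pos_functional sc \<phi> \<and> \<phi> \<noteq> (\<lambda>_. 0) \<longrightarrow>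
                    (\<exists>t\<in>{0..}. \<phi> (T t f) \<noteq> 0));
            iii = persistently_irreducible sc T;
            iv = (\<forall>f \<phi>. \<forall>t\<^sub>0\<ge>0. 0 \<le> f \<and> f \<noteq> 0 \<and> pos_functional sc \<phi> \<and> \<phi> \<noteq> (\<lambda>_. 0) \<longrightarrow>
                    (\<exists>t\<in>{0} \<union> {t\<^sub>0..}. \<phi> (T t f) \<noteq> 0));
            v = (\<forall>f \<phi>. \<forall>t\<^sub>0\<ge>0. 0 \<le> f \<and> f \<noteq> 0 \<and> pos_functional sc \<phi> \<and> \<phi> \<noteq> (\<lambda>_. 0) \<longrightarrow>
                    (\<exists>t\<in>{t\<^sub>0..}. \<phi> (T t f) \<noteq> 0))
        in (iii \<longleftrightarrow> iv) \<and> (iv \<longleftrightarrow> v) \<and> (iii \<longrightarrow> i) \<and> (iv \<longrightarrow> ii) \<and> (ii \<longrightarrow> i)"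
proof -
  have fold: "(\<forall>f \<phi>. \<forall>t\<^sub>0\<ge>0. 0 \<le> f \<and> f \<noteq> 0 \<and> pos_functional sc \<phi> \<and> \<phi> \<noteq> (\<lambda>_. 0) \<longrightarrow>
      (\<exists>t\<in>M t\<^sub>0. \<phi> (T t f) \<noteq> 0)) \<longleftrightarrow> (\<forall>t\<^sub>0\<ge>0. hits sc T (M t\<^sub>0))" for M :: "real \<Rightarrow> real set"
    unfolding hits_def by blast
  have "persistently_irreducible sc T \<longrightarrow> irreducible_semigroup sc T"
    unfolding persistently_irreducible_iff irreducible_semigroup_def by blast
  moreover have "hits sc T {0..}" if "\<forall>t\<^sub>0\<ge>0. hits sc T ({0} \<union> {t\<^sub>0..})"
  proof -
    have "{0} \<union> {0..} = {0::real..}" by auto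
    then show ?thesis using that by (metis order_refl)
  qed
  ultimately show ?thesis
    unfolding Let_def fold hits_def[symmetric] using assms by blast
qed

lemma complex_irreducibility_implications:
  fixes S :: "real \<Rightarrow> 'a::banach_lattice complexification \<Rightarrow> 'a complexification"
  assumes S: "C0_semigroup scaleC S" and R: "real_semigroup S" and pos: "indiv_eventually_positive S"
  shows "persistently_irreducible scaleC S \<longleftrightarrow> (\<forall>t\<^sub>0\<ge>0. hits scaleC S ({0} \<union> {t\<^sub>0..}))"
    and "(\<forall>t\<^sub>0\<ge>0. hits scaleC S ({0} \<union> {t\<^sub>0..})) \<longleftrightarrow> (\<forall>t\<^sub>0\<ge>0. hits scaleC S {t\<^sub>0..})"
    and "hits scaleC S {0..} \<longrightarrow> irreducible_semigroup scaleC S"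
proof -
  let ?R = "real_restriction S"
  have hits: "hits scaleC S {t..} \<longleftrightarrow> hits scaleR ?R {t..}"
    "hits scaleC S ({0} \<union> {t..}) \<longleftrightarrow> hits scaleR ?R ({0} \<union> {t..})" if "0 \<le> t" for t
    using that by (intro hits_real_restriction_iff[OF S R]; force)+
  note real = real_irreducibility_implications[OF C0_semigroup_real_restriction[OF S R]
      indiv_eventually_positive_real_restriction[OF pos]]
  note irr = irreducible_real_restriction_iff[OF S R] persistently_irreducible_real_restriction_iff[OF S R]
  show "persistently_irreducible scaleC S \<longleftrightarrow> (\<forall>t\<^sub>0\<ge>0. hits scaleC S ({0} \<union> {t\<^sub>0..}))"
    using real(1) hits irr by metis
  show "(\<forall>t\<^sub>0\<ge>0. hits scaleC S ({0} \<union> {t\<^sub>0..})) \<longleftrightarrow> (\<forall>t\<^sub>0\<ge>0. hits scaleC S {t\<^sub>0..})"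
    using real(2) hits by metis
  show "hits scaleC S {0..} \<longrightarrow> irreducible_semigroup scaleC S"
    using real(3) hits(1)[of 0] irr by simp
qed

theorem theorem3p6:
  fixes T :: "real \<Rightarrow> 'a::banach_lattice \<Rightarrow> 'a" and A :: "('a \<times> 'a) set"
    and S :: "real \<Rightarrow> 'b::banach_lattice complexification \<Rightarrow> 'b complexification"
    and B :: "('b complexification \<times> 'b complexification) set"
  shows
    "(C0_semigroup scaleR T \<and> A = generator T \<and> indiv_eventually_positive T \<longrightarrow>
       (let i = irreducible_semigroup scaleR T;
            ii = (\<forall>f \<phi>. 0 \<le> f \<and> f \<noteq> 0 \<and> pos_functional scaleR \<phi> \<and> \<phi> \<noteq> (\<lambda>_. 0) \<longrightarrow>
                    (\<exists>t\<in>{0..}. \<phi> (T t f) \<noteq> 0));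
            iii = persistently_irreducible scaleR T;
            iv = (\<forall>f \<phi>. \<forall>t\<^sub>0\<ge>0. 0 \<le> f \<and> f \<noteq> 0 \<and> pos_functional scaleR \<phi> \<and> \<phi> \<noteq> (\<lambda>_. 0) \<longrightarrow>
                    (\<exists>t\<in>{0} \<union> {t\<^sub>0..}. \<phi> (T t f) \<noteq> 0));
            v = (\<forall>f \<phi>. \<forall>t\<^sub>0\<ge>0. 0 \<le> f \<and> f \<noteq> 0 \<and> pos_functional scaleR \<phi> \<and> \<phi> \<noteq> (\<lambda>_. 0) \<longrightarrow>
                    (\<exists>t\<in>{t\<^sub>0..}. \<phi> (T t f) \<noteq> 0))
        in (iii \<longleftrightarrow> iv) \<and> (iv \<longleftrightarrow> v) \<and> (iii \<longrightarrow> i) \<and> (iv \<longrightarrow> ii) \<and> (ii \<longrightarrow> i)))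
     \<and>
     (C0_semigroup scaleC S \<and> B = generator S \<and> real_semigroup S \<and> indiv_eventually_positive S \<longrightarrow>
       (let i = irreducible_semigroup scaleC S;
            ii = (\<forall>f \<phi>. 0 \<le> f \<and> f \<noteq> 0 \<and> pos_functional scaleC \<phi> \<and> \<phi> \<noteq> (\<lambda>_. 0) \<longrightarrow>
                    (\<exists>t\<in>{0..}. \<phi> (S t f) \<noteq> 0));
            iii = persistently_irreducible scaleC S;
            iv = (\<forall>f \<phi>. \<forall>t\<^sub>0\<ge>0. 0 \<le> f \<and> f \<noteq> 0 \<and> pos_functional scaleC \<phi> \<and> \<phi> \<noteq> (\<lambda>_. 0) \<longrightarrow>
                    (\<exists>t\<in>{0} \<union> {t\<^sub>0..}. \<phi> (S t f) \<noteq> 0));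
            v = (\<forall>f \<phi>. \<forall>t\<^sub>0\<ge>0. 0 \<le> f \<and> f \<noteq> 0 \<and> pos_functional scaleC \<phi> \<and> \<phi> \<noteq> (\<lambda>_. 0) \<longrightarrow>
                    (\<exists>t\<in>{t\<^sub>0..}. \<phi> (S t f) \<noteq> 0))
        in (iii \<longleftrightarrow> iv) \<and> (iv \<longleftrightarrow> v) \<and> (iii \<longrightarrow> i) \<and> (iv \<longrightarrow> ii) \<and> (ii \<longrightarrow> i)))"
  by (rule conjI; rule impI; elim conjE; rule irreducibility_equivalences)
    (rule real_irreducibility_implications complex_irreducibility_implications; assumption)+

end
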